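(* For each $n\ge 1$, let $\boldsymbol\sigma_n$ be a uniformly random 231-avoiding permutation of size $n$. Then $(\boldsymbol\sigma_n)_{n\ge1}$ satisfies a convergence law: for every first-order sentence $\Psi$ in the language of two total orders $\{<_P,<_V\}$, the limit $\lim_{n\to\infty}\mathbb P(\boldsymbol\sigma_n\models\Psi)$ exists. Moreover: (i) for every such first-order sentence $\Psi$, either $\lim_{n\to\infty}\mathbb P(\boldsymbol\sigma_n\models\Psi)>0$, or there exists $\varepsilon=\varepsilon(\Psi)<1$ such that $\mathbb P(\boldsymbol\sigma_n\models\Psi)=O(\varepsilon^n)$; (ii) the set $\{\lim_{n\to\infty}\mathbb P(\boldsymbol\sigma_n\models\Psi) : \Psi \text{ a first-order sentence}\}$ is dense in $[0,1]$.
   Context: A permutation $\sigma$ of size $n$ is viewed as a finite model of the theory of two orders: the set $A^\sigma$ of points $(i,\sigma(i))$ of its permutation diagram, equipped with two linear orders $<_P$ (comparing positions, i.e. $x$-coordinates) and $<_V$ (comparing values, i.e. $y$-coordinates). First-order sentences are built from atomic formulas $x=y$, $x<_P y$, $x<_V y$ using $\neg,\wedge,\vee,\Rightarrow,\Leftrightarrow$ and quantifiers $\forall x,\exists x$ over elements, with no free variables; $\sigma\models\Psi$ means $\Psi$ holds when interpreted in $(A^\sigma,<_P,<_V)$. A permutation $\sigma$ avoids $231$ if there are no indices $i<j<l$ with $\sigma(l)<\sigma(i)<\sigma(j)$. *)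

theory Defs
  imports "HOL-Probability.Probability" "HOL-Combinatorics.Permutations"
    "HOL-Library.Landau_Symbols"
begin

datatype too_formula =
    Eq nat nat
  | LessP nat nat
  | LessV nat nat
  | Neg too_formula
  | Conj too_formula too_formula
  | Disj too_formula too_formula
  | Imp too_formula too_formula
  | Iff too_formula too_formula
  | Forall nat too_formula
  | Exists nat too_formula

fun free_vars :: "too_formula \<Rightarrow> nat set" where
  "free_vars (Eq x y) = {x, y}"
| "free_vars (LessP x y) = {x, y}"
| "free_vars (LessV x y) = {x, y}"
| "free_vars (Neg \<phi>) = free_vars \<phi>"
| "free_vars (Conj \<phi> \<psi>) = free_vars \<phi> \<union> free_vars \<psi>"
| "free_vars (Disj \<phi> \<psi>) = free_vars \<phi> \<union> free_vars \<psi>"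
| "free_vars (Imp \<phi> \<psi>) = free_vars \<phi> \<union> free_vars \<psi>"
| "free_vars (Iff \<phi> \<psi>) = free_vars \<phi> \<union> free_vars \<psi>"
| "free_vars (Forall x \<phi>) = free_vars \<phi> - {x}"
| "free_vars (Exists x \<phi>) = free_vars \<phi> - {x}"

definition sentence :: "too_formula \<Rightarrow> bool" where
  "sentence \<phi> \<longleftrightarrow> free_vars \<phi> = {}"

fun satisfies ::
  "'a set \<Rightarrow> ('a \<Rightarrow> 'a \<Rightarrow> bool) \<Rightarrow> ('a \<Rightarrow> 'a \<Rightarrow> bool) \<Rightarrow> (nat \<Rightarrow> 'a) \<Rightarrow> too_formula \<Rightarrow> bool"
where
  "satisfies A P V e (Eq x y) \<longleftrightarrow> e x = e y"
| "satisfies A P V e (LessP x y) \<longleftrightarrow> P (e x) (e y)"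
| "satisfies A P V e (LessV x y) \<longleftrightarrow> V (e x) (e y)"
| "satisfies A P V e (Neg \<phi>) \<longleftrightarrow> \<not> satisfies A P V e \<phi>"
| "satisfies A P V e (Conj \<phi> \<psi>) \<longleftrightarrow> satisfies A P V e \<phi> \<and> satisfies A P V e \<psi>"
| "satisfies A P V e (Disj \<phi> \<psi>) \<longleftrightarrow> satisfies A P V e \<phi> \<or> satisfies A P V e \<psi>"
| "satisfies A P V e (Imp \<phi> \<psi>) \<longleftrightarrow> (satisfies A P V e \<phi> \<longrightarrow> satisfies A P V e \<psi>)"
| "satisfies A P V e (Iff \<phi> \<psi>) \<longleftrightarrow> (satisfies A P V e \<phi> \<longleftrightarrow> satisfies A P V e \<psi>)"
| "satisfies A P V e (Forall x \<phi>) \<longleftrightarrow> (\<forall>a\<in>A. satisfies A P V (e(x := a)) \<phi>)"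
| "satisfies A P V e (Exists x \<phi>) \<longleftrightarrow> (\<exists>a\<in>A. satisfies A P V (e(x := a)) \<phi>)"

lemma satisfies_cong:
  assumes "\<And>x. x \<in> free_vars \<phi> \<Longrightarrow> e x = e' x"
  shows "satisfies A P V e \<phi> \<longleftrightarrow> satisfies A P V e' \<phi>"
  using assms
proof (induction \<phi> arbitrary: e e')
  case (Forall x \<phi>)
  have "satisfies A P V (e(x := a)) \<phi> \<longleftrightarrow> satisfies A P V (e'(x := a)) \<phi>" for a
    by (rule Forall.IH) (use Forall.prems in auto)
  then show ?case by simp
next
  case (Exists x \<phi>)
  have "satisfies A P V (e(x := a)) \<phi> \<longleftrightarrow> satisfies A P V (e'(x := a)) \<phi>" for a
    by (rule Exists.IH) (use Exists.prems in auto)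
  then show ?case by simp
next
  case (Neg \<phi>)
  show ?case using Neg.IH[of e e'] Neg.prems by simp
next
  case (Conj \<phi> \<psi>)
  show ?case using Conj.IH(1,2)[of e e'] Conj.prems by simp
next
  case (Disj \<phi> \<psi>)
  show ?case using Disj.IH(1,2)[of e e'] Disj.prems by simp
next
  case (Imp \<phi> \<psi>)
  show ?case using Imp.IH(1,2)[of e e'] Imp.prems by simp
next
  case (Iff \<phi> \<psi>)
  show ?case using Iff.IH(1,2)[of e e'] Iff.prems by simp
qed simp_all

definition diagram :: "nat \<Rightarrow> (nat \<Rightarrow> nat) \<Rightarrow> (nat \<times> nat) set" where
  "diagram n \<sigma> = (\<lambda>i. (i, \<sigma> i)) ` {1..n}"

definition less_P :: "nat \<times> nat \<Rightarrow> nat \<times> nat \<Rightarrow> bool" where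
  "less_P p q \<longleftrightarrow> fst p < fst q"

definition less_V :: "nat \<times> nat \<Rightarrow> nat \<times> nat \<Rightarrow> bool" where
  "less_V p q \<longleftrightarrow> snd p < snd q"

text \<open>The assignment below is a dummy: by \<open>satisfies_cong\<close> its choice is
  irrelevant for a sentence.\<close>

definition models :: "nat \<Rightarrow> (nat \<Rightarrow> nat) \<Rightarrow> too_formula \<Rightarrow> bool" where
  "models n \<sigma> \<Psi> \<longleftrightarrow> satisfies (diagram n \<sigma>) less_P less_V (\<lambda>_. undefined) \<Psi>"

definition avoids_231 :: "nat \<Rightarrow> (nat \<Rightarrow> nat) \<Rightarrow> bool" where
  "avoids_231 n \<sigma> \<longleftrightarrow>
    \<not> (\<exists>i\<in>{1..n}. \<exists>j\<in>{1..n}. \<exists>l\<in>{1..n}. i < j \<and> j < l \<and> \<sigma> l < \<sigma> i \<and> \<sigma> i < \<sigma> j)"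

definition Av231 :: "nat \<Rightarrow> (nat \<Rightarrow> nat) set" where
  "Av231 n = {\<sigma>. \<sigma> permutes {1..n} \<and> avoids_231 n \<sigma>}"

lemma finite_Av231: "finite (Av231 n)"
  unfolding Av231_def by (rule finite_subset[OF _ finite_permutations[of "{1..n}"]]) auto

lemma Av231_nonempty: "Av231 n \<noteq> {}"
proof -
  have "id \<in> Av231 n"
    by (auto simp: Av231_def avoids_231_def permutes_id)
  then show ?thesis by blast
qed

definition random_Av231 :: "nat \<Rightarrow> (nat \<Rightarrow> nat) pmf" where
  "random_Av231 n = pmf_of_set (Av231 n)"

definition sat_prob :: "too_formula \<Rightarrow> nat \<Rightarrow> real" where
  "sat_prob \<Psi> n = measure_pmf.prob (random_Av231 n) {\<sigma>. models n \<sigma> \<Psi>}"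

end

theory Submission
  imports Defs "HOL-Real_Asymp.Real_Asymp"
begin

text \<open>231-avoiding permutations of size \<open>n\<close> correspond to binary trees with \<open>n\<close> inner nodes, so they
  are counted by the Catalan numbers, and \<open>k\<close>-equivalence (agreement on sentences of quantifier
  depth \<open>k\<close>) is a congruence of finite index for the tree constructors. As first-order logic cannot
  count repetitions of a block, the finite monoid of classes under direct sum is aperiodic; an
  idempotent \<open>e\<close> of its minimal ideal satisfies \<open>e y e = e\<close>. Hence there is a context \<open>h\<close> such that
  \<open>h[t]\<close> is \<open>k\<close>-equivalent to \<open>e\<close> for all \<open>t\<close>.

  In a large random tree one of the two subtrees of the root has bounded size with probability close
  to 1. So the oscillation of the probabilities of a set \<open>S\<close> is at most the average, with weights
  \<open>4 ^ -|g|\<close>, of the oscillations of \<open>{t. g[t] \<in> S}\<close> over the one-step contexts \<open>g\<close>. Following the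
  constant context \<open>h\<close> this becomes a strict contraction, hence the probabilities converge.

  If a model of the sentence has a subtree \<open>e\<close>, then a positive proportion of all trees are models;
  otherwise all models avoid the subtree \<open>e\<close>, and such trees have growth rate below 4. Finally, the
  sentence saying that the maximum is preceded by \<open>l\<close> elements with \<open>l\<close> in a finite set \<open>F\<close> has
  probability tending to a subset sum of the weights \<open>C_l / 4 ^ (l + 1)\<close>, and these sums are dense in
  \<open>[0, 1/2]\<close>; negation gives the other half.\<close>

section \<open>Binary trees and Catalan numbers\<close>

datatype tr = Lf | Nd tr tr

definition trees :: "nat \<Rightarrow> tr set" where
  "trees n = {t. size t = n}"

definition cat :: "nat \<Rightarrow> nat" where
  "cat n = card (trees n)"

lemma trees_0: "trees 0 = {Lf}"
proof -
  have "size t = 0 \<longleftrightarrow> t = Lf" for t :: tr by (cases t) auto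
  then show ?thesis by (auto simp: trees_def)
qed

lemma trees_Suc: "trees (Suc n) = (\<Union>i\<le>n. case_prod Nd ` (trees i \<times> trees (n - i)))"
proof (intro equalityI subsetI)
  fix t assume "t \<in> trees (Suc n)"
  then obtain l r where t: "t = Nd l r" "size l + size r = n"
    by (cases t) (auto simp: trees_def)
  then have "size l \<le> n" "l \<in> trees (size l)" "r \<in> trees (n - size l)"
    by (auto simp: trees_def)
  then show "t \<in> (\<Union>i\<le>n. case_prod Nd ` (trees i \<times> trees (n - i)))" using t by force
qed (auto simp: trees_def)

lemma finite_trees [simp]: "finite (trees n)"
proof (induction n rule: less_induct)
  case (less n)
  show ?case
  proof (cases n)
    case 0 then show ?thesis by (simp add: trees_0)
  next
    case (Suc m)
    then show ?thesis using less by (auto simp: trees_Suc)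
  qed
qed

lemma cat_0: "cat 0 = 1"
  by (simp add: cat_def trees_0)

lemma cat_convolution: "cat (Suc n) = (\<Sum>i\<le>n. cat i * cat (n - i))"
proof -
  have "cat (Suc n) = (\<Sum>i\<le>n. card (case_prod Nd ` (trees i \<times> trees (n - i))))"
    unfolding cat_def trees_Suc
    by (rule card_UN_disjoint) (auto simp: trees_def[abs_def] intro!: finite_imageI finite_cartesian_product finite_trees[unfolded trees_def])
  also have "\<dots> = (\<Sum>i\<le>n. cat i * cat (n - i))"
    by (intro sum.cong refl) (subst card_image, auto simp: inj_on_def cat_def card_cartesian_product)
  finally show ?thesis .
qed

text \<open>The coefficients of \<open>(1 - sqrt (1 - 4 x)) / (2 x)\<close>.\<close>

definition catg :: "nat \<Rightarrow> real" where
  "catg n = - (1/2) * ((1/2) gchoose (Suc n)) * (-4) ^ Suc n"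

text \<open>The half-binomials are the coefficients of \<open>sqrt (1 + x)\<close>, whose square has
  no term of degree above 1. So Vandermonde with 1/2 + 1/2 = 1 gives 0, and splitting off the two
  extreme terms leaves the convolution.\<close>

lemma catg_convolution: "catg (Suc n) = (\<Sum>i\<le>n. catg i * catg (n - i))"
proof -
  let ?b = "\<lambda>k. (1/2 :: real) gchoose k"
  have one: "(1::real) gchoose (Suc (Suc n)) = 0"
    using binomial_gbinomial[of 1 "Suc (Suc n)", where 'a = real] by simp
  have V: "(\<Sum>k\<le>Suc (Suc n). ?b k * ?b (Suc (Suc n) - k)) = 0"
    using gbinomial_Vandermonde[of "1/2::real" "1/2" "Suc (Suc n)"]
    by (simp add: atLeast0AtMost one del: sum.atMost_Suc)
  have "(\<Sum>k\<le>Suc (Suc n). ?b k * ?b (Suc (Suc n) - k))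
      = ?b (Suc (Suc n)) + (\<Sum>k\<le>Suc n. ?b (Suc k) * ?b (Suc n - k))"
    by (subst sum.atMost_Suc_shift) simp
  also have "(\<Sum>k\<le>Suc n. ?b (Suc k) * ?b (Suc n - k))
      = (\<Sum>k\<le>n. ?b (Suc k) * ?b (Suc n - k)) + ?b (Suc (Suc n))"
    by simp
  finally have E: "(\<Sum>k\<le>n. ?b (Suc k) * ?b (Suc n - k)) = - 2 * ?b (Suc (Suc n))"
    using V by simp
  have "(\<Sum>i\<le>n. catg i * catg (n - i))
      = (\<Sum>i\<le>n. (1/4) * (-4) ^ Suc (Suc n) * (?b (Suc i) * ?b (Suc n - i)))"
  proof (rule sum.cong[OF refl])
    fix i assume "i \<in> {..n}"
    then have "i \<le> n" by simp
    then have p: "(-4::real) ^ Suc i * (-4) ^ (Suc n - i) = (-4) ^ Suc (Suc n)"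
      by (simp only: power_add[symmetric]) simp
    have "Suc (n - i) = Suc n - i" using \<open>i \<le> n\<close> by simp
    then have "catg i * catg (n - i) = (1/4) * ((-4) ^ Suc i * (-4) ^ (Suc n - i)) * (?b (Suc i) * ?b (Suc n - i))"
      unfolding catg_def by simp
    then show "catg i * catg (n - i) = (1/4) * (-4) ^ Suc (Suc n) * (?b (Suc i) * ?b (Suc n - i))"
      unfolding p .
  qed
  also have "\<dots> = (1/4) * (-4) ^ Suc (Suc n) * (- 2 * ?b (Suc (Suc n)))"
    by (simp only: sum_distrib_left[symmetric] E)
  finally show ?thesis by (simp add: catg_def)
qed

lemma cat_eq_catg: "real (cat n) = catg n"
proof (induction n rule: less_induct)
  case (less n)
  show ?case
  proof (cases n)
    case 0 then show ?thesis by (simp add: cat_0 catg_def)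
  next
    case (Suc m)
    have "real (cat (Suc m)) = (\<Sum>i\<le>m. real (cat i) * real (cat (m - i)))"
      by (simp add: cat_convolution)
    also have "\<dots> = (\<Sum>i\<le>m. catg i * catg (m - i))"
      by (intro sum.cong refl) (use less Suc in auto)
    finally show ?thesis by (simp add: catg_convolution Suc)
  qed
qed

text \<open>The quadratic recursion shows no growth rate. The quotient of consecutive binomials in
  the closed form yields this linear one, on which the estimates of \<open>cat\<close> rest.\<close>

lemma cat_rec: "real (n + 2) * real (cat (Suc n)) = real (4 * n + 2) * real (cat n)"
proof -
  have "((1/2::real) gchoose Suc (Suc n)) * real (n + 2) = ((1/2) gchoose Suc n) * (1/2 - real (Suc n))"
    using gbinomial_mult_1[of "1/2::real" "Suc n"] by (simp add: algebra_simps)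
  then have "(real (n + 2) * ((1/2::real) gchoose Suc (Suc n))) * (8 * (-4) ^ n)
      = (((1/2) gchoose Suc n) * (1/2 - real (Suc n))) * (8 * (-4) ^ n)" by (simp add: mult.commute)
  then show ?thesis
    unfolding cat_eq_catg catg_def by (simp add: algebra_simps)
qed

lemma cat_pos [simp]: "cat n > 0"
proof (induction n)
  case (Suc n)
  then have "real (n + 2) * real (cat (Suc n)) > 0" by (subst cat_rec) simp
  then show ?case by (simp add: zero_less_mult_iff)
qed (simp add: cat_0)

lemma cat_Suc: "real (cat (Suc n)) = real (4 * n + 2) / real (n + 2) * real (cat n)"
  using cat_rec[of n] by (simp add: field_simps)

text \<open>The polynomial loss is harmless, since the bound is compared with growth rates below
  4.\<close>

lemma cat_lower: "4 ^ n \<le> (real n + 1)\<^sup>2 * real (cat n)"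
proof (induction n)
  case (Suc n)
  have "4 ^ Suc n \<le> 4 * ((real n + 1)\<^sup>2 * real (cat n))" using Suc by simp
  also have "\<dots> \<le> (real n + 2) * real (4 * n + 2) * real (cat n)"
  proof -
    have "4 * (real n + 1)\<^sup>2 \<le> (real n + 2) * real (4 * n + 2)"
      by (simp add: power2_eq_square algebra_simps)
    from mult_right_mono[OF this, of "real (cat n)"] show ?thesis by simp
  qed
  also have "\<dots> = (real n + 2) * (real (n + 2) * real (cat (Suc n)))"
    by (subst cat_rec) simp
  also have "\<dots> = (real (Suc n) + 1)\<^sup>2 * real (cat (Suc n))"
    by (simp add: power2_eq_square algebra_simps)
  finally show ?case .
qed (simp add: cat_0)

lemma cat_ratio: "(\<lambda>n. real (cat n) / real (cat (Suc n))) \<longlonglongrightarrow> 1/4"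
proof -
  have "real (cat n) / real (cat (Suc n)) = 1/4 + (3/2) / real (4 * n + 2)" for n
  proof -
    have "real (cat n) / (real (4 * n + 2) / real (n + 2) * real (cat n)) = real (n + 2) / real (4 * n + 2)"
      using cat_pos[of n] by (simp del: cat_pos)
    then show ?thesis
      unfolding cat_Suc by (simp add: divide_simps) (simp add: algebra_simps)
  qed
  moreover have "(\<lambda>n. 1/4 + (3/2) / real (4 * n + 2)) \<longlonglongrightarrow> 1/4 + 0"
  proof (intro tendsto_intros)
    show "(\<lambda>n. (3/2) / real (4 * n + 2)) \<longlonglongrightarrow> 0"
      by real_asymp
  qed
  ultimately show ?thesis by simp
qed

text \<open>Telescopes \<open>cat_ratio\<close>. As filling a context is injective, this is the
  asymptotic share of the trees produced by a fixed context of size \<open>l\<close>.\<close>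

lemma cat_ratio_shift: "(\<lambda>n. real (cat (n - l)) / real (cat n)) \<longlonglongrightarrow> (1/4) ^ l"
proof (induction l)
  case 0
  have "real (cat n) / real (cat n) = 1" for n using cat_pos[of n] by simp
  then show ?case by simp
next
  case (Suc l)
  have "(\<lambda>n. real (cat n) / real (cat (n + Suc l))) \<longlonglongrightarrow> (1/4) ^ Suc l"
  proof -
    have "(\<lambda>n. real (cat ((n + l) - l)) / real (cat (n + l))) \<longlonglongrightarrow> (1/4) ^ l"
      using LIMSEQ_ignore_initial_segment[OF Suc] .
    moreover have "(\<lambda>n. real (cat (n + l)) / real (cat (Suc (n + l)))) \<longlonglongrightarrow> 1/4"
      using LIMSEQ_ignore_initial_segment[OF cat_ratio] .
    ultimately have "(\<lambda>n. (real (cat (n + l - l)) / real (cat (n + l))) *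
        (real (cat (n + l)) / real (cat (Suc (n + l))))) \<longlonglongrightarrow> (1/4) ^ l * (1/4)"
      by (rule tendsto_mult)
    then show ?thesis by (simp add: mult.commute)
  qed
  then have "(\<lambda>n. real (cat ((n + Suc l) - Suc l)) / real (cat (n + Suc l))) \<longlonglongrightarrow> (1/4) ^ Suc l"
    by simp
  then show ?case by (rule LIMSEQ_offset)
qed

text \<open>The limiting probability \<open>wt l\<close> that the left subtree of the root has size \<open>l\<close>, and
  the tail sum \<open>tail_wt j\<close> of \<open>wt l\<close> over \<open>l \<ge> j\<close>.\<close>

definition wt :: "nat \<Rightarrow> real" where
  "wt l = real (cat l) / 4 ^ Suc l"

definition tail_wt :: "nat \<Rightarrow> real" where
  "tail_wt j = real (j + 1) * real (cat j) / (2 * 4 ^ j)"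

lemma tail_wt_0: "tail_wt 0 = 1/2"
  by (simp add: tail_wt_def cat_0)

lemma tail_wt_Suc_wt: "tail_wt (Suc j) = real (2 * j + 1) * wt j"
proof -
  have "tail_wt (Suc j) = (real (j + 2) * real (cat (Suc j))) / (2 * 4 ^ Suc j)"
    by (simp add: tail_wt_def)
  then show ?thesis by (simp only: cat_rec) (simp add: wt_def field_simps)
qed

text \<open>Telescoping this, with \<open>tail_wt_tendsto_0\<close>, shows that the closed form
  really is the tail sum, so no infinite series has to be handled.\<close>

lemma tail_wt_eq: "tail_wt j = wt j + tail_wt (Suc j)"
  unfolding tail_wt_Suc_wt by (simp add: tail_wt_def wt_def field_simps)

lemma wt_pos: "wt l > 0"
  by (simp add: wt_def)

lemma wt_le_tail: "wt l \<le> tail_wt (Suc l)"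
  unfolding tail_wt_Suc_wt using wt_pos[of l] by (simp add: algebra_simps)

lemma tail_wt_nonneg: "tail_wt j \<ge> 0"
  by (simp add: tail_wt_def)

lemma sum_wt: "(\<Sum>l<j. wt l) = 1/2 - tail_wt j"
proof (induction j)
  case (Suc j)
  then show ?case using tail_wt_eq[of j] by simp
qed (simp add: tail_wt_0)

text \<open>Gives decay of order 1 / sqrt j without Stirling: the squared quotient of consecutive
  terms is at most (j + 1) / (j + 2), because (2 j + 1)^2 (j + 2) \<le> 4 (j + 1)^3.\<close>

lemma tail_wt_sq: "(tail_wt j)\<^sup>2 * real (j + 1) \<le> 1/4"
proof (induction j)
  case (Suc j)
  have e: "tail_wt (Suc j) = (2 * real j + 1) / (2 * (real j + 1)) * tail_wt j"
    unfolding tail_wt_Suc_wt by (simp add: tail_wt_def wt_def divide_simps) (simp add: algebra_simps)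
  have "((2 * real j + 1) / (2 * (real j + 1)))\<^sup>2 * (real j + 2) \<le> real j + 1"
  proof -
    have "(2 * real j + 1)\<^sup>2 * (real j + 2) \<le> (real j + 1) * (2 * (real j + 1))\<^sup>2"
      by (simp add: power2_eq_square algebra_simps)
    then show ?thesis by (simp add: power_divide divide_le_eq)
  qed
  from mult_right_mono[OF this, of "(tail_wt j)\<^sup>2"]
  have "(tail_wt (Suc j))\<^sup>2 * real (Suc j + 1) \<le> (tail_wt j)\<^sup>2 * real (j + 1)"
    unfolding e power_mult_distrib by (simp add: algebra_simps)
  then show ?case using Suc by simp
qed (simp add: tail_wt_0 power2_eq_square)

lemma tail_wt_tendsto_0: "tail_wt \<longlonglongrightarrow> 0"
proof -
  have "(\<lambda>j. (tail_wt j)\<^sup>2) \<longlonglongrightarrow> 0"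
  proof (rule tendsto_sandwich[where f = "\<lambda>_. 0"])
    show "\<forall>\<^sub>F j in sequentially. (tail_wt j)\<^sup>2 \<le> (1/4) / real (j + 1)"
      using tail_wt_sq by (auto simp: field_simps)
    show "(\<lambda>j. (1/4) / real (j + 1)) \<longlonglongrightarrow> 0" by real_asymp
  qed auto
  then show ?thesis using tendsto_real_sqrt[of "\<lambda>j. (tail_wt j)\<^sup>2" 0]
    by (simp add: tail_wt_nonneg)
qed

section \<open>Ehrenfeucht--Fraisse games\<close>

definition partial_iso :: "((nat \<times> nat) \<times> (nat \<times> nat)) set \<Rightarrow> bool" where
  "partial_iso R \<longleftrightarrow> (\<forall>a b a' b'. (a, b) \<in> R \<longrightarrow> (a', b') \<in> R \<longrightarrow>
     (a = a' \<longleftrightarrow> b = b') \<and> (less_P a a' \<longleftrightarrow> less_P b b') \<and> (less_V a a' \<longleftrightarrow> less_V b b'))"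

lemma partial_isoI:
  assumes "\<And>a b a' b'. (a, b) \<in> R \<Longrightarrow> (a', b') \<in> R \<Longrightarrow>
     (a = a' \<longleftrightarrow> b = b') \<and> (less_P a a' \<longleftrightarrow> less_P b b') \<and> (less_V a a' \<longleftrightarrow> less_V b b')"
  shows "partial_iso R"
  unfolding partial_iso_def using assms by simp

lemma partial_isoD:
  assumes "partial_iso R" "(a, b) \<in> R" "(a', b') \<in> R"
  shows "(a = a' \<longleftrightarrow> b = b') \<and> (less_P a a' \<longleftrightarrow> less_P b b') \<and> (less_V a a' \<longleftrightarrow> less_V b b')"
  using assms(1)[unfolded partial_iso_def, rule_format, OF assms(2,3)] .

text \<open>Duplicator wins the \<open>k\<close>-round game on \<open>A\<close> and \<open>B\<close> in which the pairs in \<open>R\<close> have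
  already been played.\<close>

fun ef :: "nat \<Rightarrow> (nat \<times> nat) set \<Rightarrow> (nat \<times> nat) set \<Rightarrow> ((nat \<times> nat) \<times> (nat \<times> nat)) set \<Rightarrow> bool" where
  "ef 0 A B R \<longleftrightarrow> R \<subseteq> A \<times> B \<and> partial_iso R"
| "ef (Suc k) A B R \<longleftrightarrow> R \<subseteq> A \<times> B \<and> partial_iso R \<and>
     (\<forall>a\<in>A. \<exists>b\<in>B. ef k A B (insert (a, b) R)) \<and>
     (\<forall>b\<in>B. \<exists>a\<in>A. ef k A B (insert (a, b) R))"

lemma ef_subset: "ef k A B R \<Longrightarrow> R \<subseteq> A \<times> B"
  by (cases k) auto

lemma ef_partial_iso: "ef k A B R \<Longrightarrow> partial_iso R"
  by (cases k) auto

lemma partial_iso_mono: "partial_iso R' \<Longrightarrow> R \<subseteq> R' \<Longrightarrow> partial_iso R"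
  using partial_isoD[of R'] by (intro partial_isoI) blast

text \<open>Forgetting played pairs only removes constraints. Positions are often built with too
  many pairs and cut down by this lemma.\<close>

lemma ef_mono: "ef k A B R' \<Longrightarrow> R \<subseteq> R' \<Longrightarrow> ef k A B R"
proof (induction k arbitrary: R R')
  case 0
  then show ?case using partial_iso_mono by auto
next
  case (Suc k)
  have i: "insert p R \<subseteq> insert p R'" for p using Suc.prems(2) by auto
  have "ef k A B (insert p R)" if "ef k A B (insert p R')" for p
    using Suc.IH[OF that i] .
  moreover have "R \<subseteq> A \<times> B" "partial_iso R"
    using Suc.prems partial_iso_mono by auto
  ultimately show ?case using Suc.prems(1)[unfolded ef.simps(2)] unfolding ef.simps(2) by blast
qed

lemma ef_Suc_imp: "ef (Suc k) A B R \<Longrightarrow> ef k A B R"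
proof (induction k arbitrary: R)
  case (Suc k)
  then show ?case using ef.simps(2)[of "Suc k" A B R] ef.simps(2)[of k A B R] by blast
qed simp

text \<open>Starting from the full identity makes the induction immediate, since a copying answer
  does not change the position.\<close>

lemma ef_refl: "ef k A A (Id_on A)"
proof (induction k)
  case 0
  then show ?case by (auto simp: partial_iso_def)
next
  case (Suc k)
  have "insert (a, a) (Id_on A) = Id_on A" if "a \<in> A" for a using that by auto
  then have "ef k A A (insert (a, a) (Id_on A))" if "a \<in> A" for a using that Suc by simp
  then show ?case using ef_subset[OF Suc] ef_partial_iso[OF Suc] by auto
qed

lemma partial_iso_converse: "partial_iso R \<Longrightarrow> partial_iso (R\<inverse>)"
  by (rule partial_isoI) (use partial_isoD[of R] in auto)

lemma ef_sym: "ef k A B R \<Longrightarrow> ef k B A (R\<inverse>)"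
proof (induction k arbitrary: R)
  case 0
  then show ?case using partial_iso_converse by auto
next
  case (Suc k)
  have i: "insert (b, a) (R\<inverse>) = (insert (a, b) R)\<inverse>" for a b by auto
  have "partial_iso (R\<inverse>)" "R\<inverse> \<subseteq> B \<times> A"
    using Suc.prems partial_iso_converse by auto
  moreover have "ef k B A (insert (b, a) (R\<inverse>))" if "ef k A B (insert (a, b) R)" for a b
    unfolding i using Suc.IH[OF that] .
  ultimately show ?case using Suc.prems[unfolded ef.simps(2)] unfolding ef.simps(2) by blast
qed

lemma partial_iso_comp: "partial_iso R \<Longrightarrow> partial_iso S \<Longrightarrow> partial_iso (R O S)"
  by (rule partial_isoI) (use partial_isoD[of R] partial_isoD[of S] in blast)

text \<open>Each move is passed on through the middle structure: the answer given in
  \<open>B\<close> is played as a move in the second game.\<close>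

lemma ef_trans: "ef k A B R \<Longrightarrow> ef k B C S \<Longrightarrow> ef k A C (R O S)"
proof (induction k arbitrary: R S)
  case 0
  then show ?case using partial_iso_comp by auto
next
  case (Suc k)
  have i: "ef k A C (insert (a, c) (R O S))"
    if "ef k A B (insert (a, b) R)" "ef k B C (insert (b, c) S)" for a b c
    by (rule ef_mono[OF Suc.IH[OF that]]) auto
  have "R O S \<subseteq> A \<times> C" "partial_iso (R O S)"
    using Suc.prems partial_iso_comp by auto
  moreover have "\<exists>c\<in>C. ef k A C (insert (a, c) (R O S))" if a: "a \<in> A" for a
  proof -
    obtain b where b: "b \<in> B" "ef k A B (insert (a, b) R)" using Suc.prems(1) a by auto
    obtain c where c: "c \<in> C" "ef k B C (insert (b, c) S)" using Suc.prems(2) b(1) by auto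
    show ?thesis using i[OF b(2) c(2)] c(1) by blast
  qed
  moreover have "\<exists>a\<in>A. ef k A C (insert (a, c) (R O S))" if c: "c \<in> C" for c
  proof -
    obtain b where b: "b \<in> B" "ef k B C (insert (b, c) S)" using Suc.prems(2) c by auto
    obtain a where a: "a \<in> A" "ef k A B (insert (a, b) R)" using Suc.prems(1) b(1) by auto
    show ?thesis using i[OF a(2) b(2)] a(1) by blast
  qed
  ultimately show ?case by simp
qed

section \<open>Shifting and gluing games\<close>

definition sh :: "nat \<Rightarrow> nat \<Rightarrow> nat \<times> nat \<Rightarrow> nat \<times> nat" where
  "sh p q a = (fst a + p, snd a + q)"

lemma less_sh [simp]: "less_P (sh p q a) (sh p q b) \<longleftrightarrow> less_P a b"
    "less_V (sh p q a) (sh p q b) \<longleftrightarrow> less_V a b"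
    "sh p q a = sh p q b \<longleftrightarrow> a = b"
  by (auto simp: sh_def less_P_def less_V_def prod_eq_iff)

lemma sh_sh [simp]: "sh p q (sh p' q' a) = sh (p + p') (q + q') a"
  by (simp add: sh_def)

lemma sh_0 [simp]: "sh 0 0 = id"
  by (auto simp: sh_def fun_eq_iff)

lemma partial_iso_sh:
  assumes "partial_iso R"
  shows "partial_iso (map_prod (sh p q) (sh p' q') ` R)"
proof (rule partial_isoI)
  fix x y x' y' assume "(x, y) \<in> map_prod (sh p q) (sh p' q') ` R" "(x', y') \<in> map_prod (sh p q) (sh p' q') ` R"
  then obtain a b a' b' where R: "(a, b) \<in> R" "(a', b') \<in> R"
    and x: "x = sh p q a" "y = sh p' q' b" "x' = sh p q a'" "y' = sh p' q' b'"
    by auto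
  show "(x = x' \<longleftrightarrow> y = y') \<and> (less_P x x' \<longleftrightarrow> less_P y y') \<and> (less_V x x' \<longleftrightarrow> less_V y y')"
    using partial_isoD[OF assms R] unfolding x less_sh .
qed

lemma ef_sh:
  "ef k A B R \<Longrightarrow> ef k (sh p q ` A) (sh p' q' ` B) (map_prod (sh p q) (sh p' q') ` R)"
proof (induction k arbitrary: R)
  case 0
  then show ?case using partial_iso_sh[of R] by auto
next
  case (Suc k)
  let ?f = "map_prod (sh p q) (sh p' q')"
  have i: "insert (sh p q a, sh p' q' b) (?f ` R) = ?f ` (insert (a, b) R)" for a b by simp
  have "partial_iso (?f ` R)" "?f ` R \<subseteq> sh p q ` A \<times> sh p' q' ` B"
    using Suc.prems partial_iso_sh[of R] by auto
  moreover have "ef k (sh p q ` A) (sh p' q' ` B) (insert (sh p q a, sh p' q' b) (?f ` R))"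
    if "ef k A B (insert (a, b) R)" for a b
    unfolding i using Suc.IH[OF that] .
  ultimately show ?case using Suc.prems[unfolded ef.simps(2)] unfolding ef.simps(2) by blast
qed

text \<open>The gluing condition: mixed comparisons between the two parts have a fixed outcome, the
  same in both structures, so mixed pairs can never spoil a partial isomorphism.\<close>

definition uniform :: "(nat \<times> nat) set \<Rightarrow> (nat \<times> nat) set \<Rightarrow> (nat \<times> nat) set \<Rightarrow> (nat \<times> nat) set \<Rightarrow> bool" where
  "uniform A A' B B' \<longleftrightarrow> (\<forall>a\<in>A. \<forall>a'\<in>A'. \<forall>b\<in>B. \<forall>b'\<in>B'. a \<noteq> a' \<and> b \<noteq> b' \<and>
     (less_P a a' \<longleftrightarrow> less_P b b') \<and> (less_V a a' \<longleftrightarrow> less_V b b') \<and>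
     (less_P a' a \<longleftrightarrow> less_P b' b) \<and> (less_V a' a \<longleftrightarrow> less_V b' b))"

lemma partial_iso_Un:
  assumes u: "uniform A A' B B'" and R: "partial_iso R" "R \<subseteq> A \<times> B"
    and S: "partial_iso S" "S \<subseteq> A' \<times> B'"
  shows "partial_iso (R \<union> S)"
proof (rule partial_isoI)
  fix a b a' b' assume "(a, b) \<in> R \<union> S" "(a', b') \<in> R \<union> S"
  then consider (RR) "(a, b) \<in> R" "(a', b') \<in> R" | (SS) "(a, b) \<in> S" "(a', b') \<in> S"
    | (RS) "(a, b) \<in> R" "(a', b') \<in> S" | (SR) "(a, b) \<in> S" "(a', b') \<in> R" by blast
  then show "(a = a' \<longleftrightarrow> b = b') \<and> (less_P a a' \<longleftrightarrow> less_P b b') \<and> (less_V a a' \<longleftrightarrow> less_V b b')"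
  proof cases
    case RR then show ?thesis using partial_isoD[OF R(1)] by blast
  next
    case SS then show ?thesis using partial_isoD[OF S(1)] by blast
  next
    case RS
    then have "a \<in> A" "b \<in> B" "a' \<in> A'" "b' \<in> B'" using R(2) S(2) by auto
    with u[unfolded uniform_def, rule_format, of a a' b b'] show ?thesis by simp
  next
    case SR
    then have "a' \<in> A" "b' \<in> B" "a \<in> A'" "b \<in> B'" using R(2) S(2) by auto
    with u[unfolded uniform_def, rule_format, of a' a b' b] show ?thesis by auto
  qed
qed

text \<open>Duplicator answers in the part where Spoiler moved. The game on the other part merely
  loses a spare round, which is \<open>ef_Suc_imp\<close>.\<close>

lemma ef_Un:
  assumes u: "uniform A A' B B'"
  shows "ef k A B R \<Longrightarrow> ef k A' B' S \<Longrightarrow> ef k (A \<union> A') (B \<union> B') (R \<union> S)"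
proof (induction k arbitrary: R S)
  case 0
  then show ?case using partial_iso_Un[OF u, of R S] by auto
next
  case (Suc k)
  have S': "ef k A' B' S" "ef k A B R"
    using Suc.prems ef_Suc_imp by blast+
  have 1: "ef k (A \<union> A') (B \<union> B') (insert (a, b) (R \<union> S))" if "ef k A B (insert (a, b) R)" for a b
    using Suc.IH[OF that S'(1)] by simp
  have 2: "ef k (A \<union> A') (B \<union> B') (insert (a, b) (R \<union> S))" if "ef k A' B' (insert (a, b) S)" for a b
    using Suc.IH[OF S'(2) that] by simp
  have "partial_iso (R \<union> S)" "R \<union> S \<subseteq> (A \<union> A') \<times> (B \<union> B')"
    using Suc.prems partial_iso_Un[OF u, of R S] by auto
  moreover have "\<exists>b\<in>B \<union> B'. ef k (A \<union> A') (B \<union> B') (insert (a, b) (R \<union> S))" if "a \<in> A \<union> A'" for a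
    using that Suc.prems[unfolded ef.simps(2)] 1 2 by blast
  moreover have "\<exists>a\<in>A \<union> A'. ef k (A \<union> A') (B \<union> B') (insert (a, b) (R \<union> S))" if "b \<in> B \<union> B'" for b
    using that Suc.prems[unfolded ef.simps(2)] 1 2 by blast
  ultimately show ?case by simp
qed

section \<open>Games decide formulas of bounded quantifier depth\<close>

fun qdepth :: "too_formula \<Rightarrow> nat" where
  "qdepth (Eq x y) = 0"
| "qdepth (LessP x y) = 0"
| "qdepth (LessV x y) = 0"
| "qdepth (Neg \<phi>) = qdepth \<phi>"
| "qdepth (Conj \<phi> \<psi>) = max (qdepth \<phi>) (qdepth \<psi>)"
| "qdepth (Disj \<phi> \<psi>) = max (qdepth \<phi>) (qdepth \<psi>)"
| "qdepth (Imp \<phi> \<psi>) = max (qdepth \<phi>) (qdepth \<psi>)"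
| "qdepth (Iff \<phi> \<psi>) = max (qdepth \<phi>) (qdepth \<psi>)"
| "qdepth (Forall x \<phi>) = Suc (qdepth \<phi>)"
| "qdepth (Exists x \<phi>) = Suc (qdepth \<phi>)"

text \<open>Quantifiers correspond to moves. Only the values of free variables must be played pairs,
  so for a sentence the empty position and the dummy assignment suffice.\<close>

lemma ef_satisfies:
  assumes "ef k A B R" "qdepth \<phi> \<le> k" "\<And>x. x \<in> free_vars \<phi> \<Longrightarrow> (e x, f x) \<in> R"
  shows "satisfies A less_P less_V e \<phi> \<longleftrightarrow> satisfies B less_P less_V f \<phi>"
  using assms
proof (induction \<phi> arbitrary: k R e f)
  case (Eq x y)
  have "(e x, f x) \<in> R" "(e y, f y) \<in> R" using Eq by auto
  then show ?case using partial_isoD[OF ef_partial_iso[OF Eq(1)]] by simp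
next
  case (LessP x y)
  have "(e x, f x) \<in> R" "(e y, f y) \<in> R" using LessP by auto
  then show ?case using partial_isoD[OF ef_partial_iso[OF LessP(1)]] by simp
next
  case (LessV x y)
  have "(e x, f x) \<in> R" "(e y, f y) \<in> R" using LessV by auto
  then show ?case using partial_isoD[OF ef_partial_iso[OF LessV(1)]] by simp
next
  case (Neg \<phi>)
  then show ?case by simp
next
  case (Conj \<phi> \<psi>)
  have "satisfies A less_P less_V e \<phi> = satisfies B less_P less_V f \<phi>"
    using Conj by (intro Conj.IH) auto
  moreover have "satisfies A less_P less_V e \<psi> = satisfies B less_P less_V f \<psi>"
    using Conj by (intro Conj.IH) auto
  ultimately show ?case by simp
next
  case (Disj \<phi> \<psi>)
  have "satisfies A less_P less_V e \<phi> = satisfies B less_P less_V f \<phi>"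
    using Disj by (intro Disj.IH) auto
  moreover have "satisfies A less_P less_V e \<psi> = satisfies B less_P less_V f \<psi>"
    using Disj by (intro Disj.IH) auto
  ultimately show ?case by simp
next
  case (Imp \<phi> \<psi>)
  have "satisfies A less_P less_V e \<phi> = satisfies B less_P less_V f \<phi>"
    using Imp by (intro Imp.IH) auto
  moreover have "satisfies A less_P less_V e \<psi> = satisfies B less_P less_V f \<psi>"
    using Imp by (intro Imp.IH) auto
  ultimately show ?case by simp
next
  case (Iff \<phi> \<psi>)
  have "satisfies A less_P less_V e \<phi> = satisfies B less_P less_V f \<phi>"
    using Iff by (intro Iff.IH) auto
  moreover have "satisfies A less_P less_V e \<psi> = satisfies B less_P less_V f \<psi>"
    using Iff by (intro Iff.IH) auto
  ultimately show ?case by simp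
next
  case (Forall x \<phi>)
  then obtain k' where k: "k = Suc k'" "qdepth \<phi> \<le> k'" by (cases k) auto
  have i: "satisfies A less_P less_V (e(x := a)) \<phi> = satisfies B less_P less_V (f(x := b)) \<phi>"
    if "ef k' A B (insert (a, b) R)" for a b
    by (rule Forall.IH[OF that k(2)]) (use Forall.prems in auto)
  show ?case using Forall.prems(1)[unfolded k ef.simps(2)] i unfolding satisfies.simps by metis
next
  case (Exists x \<phi>)
  then obtain k' where k: "k = Suc k'" "qdepth \<phi> \<le> k'" by (cases k) auto
  have i: "satisfies A less_P less_V (e(x := a)) \<phi> = satisfies B less_P less_V (f(x := b)) \<phi>"
    if "ef k' A B (insert (a, b) R)" for a b
    by (rule Exists.IH[OF that k(2)]) (use Exists.prems in auto)
  show ?case using Exists.prems(1)[unfolded k ef.simps(2)] i unfolding satisfies.simps by metis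
qed

section \<open>Finitely many types for each number of rounds\<close>

text \<open>The natural type of the codes grows with each round. Renaming finitely many codes by
  naturals keeps the type fixed, as an induction on \<open>k\<close> requires.\<close>

lemma type_code_from_finite_range:
  fixes D :: "(nat \<times> nat) set \<times> (nat \<Rightarrow> nat \<times> nat) \<Rightarrow> 'c"
  assumes "\<And>A e B f. D (A, e) = D (B, f) \<Longrightarrow> e ` {..<m} \<subseteq> A \<Longrightarrow> f ` {..<m} \<subseteq> B \<Longrightarrow>
      ef k A B ((\<lambda>i. (e i, f i)) ` {..<m})"
    and fin: "finite (range D)"
  shows "\<exists>c :: (nat \<times> nat) set \<times> (nat \<Rightarrow> nat \<times> nat) \<Rightarrow> nat. finite (range c) \<and>
     (\<forall>A e B f. c (A, e) = c (B, f) \<longrightarrow> e ` {..<m} \<subseteq> A \<longrightarrow> f ` {..<m} \<subseteq> B \<longrightarrow>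
        ef k A B ((\<lambda>i. (e i, f i)) ` {..<m}))"
proof -
  obtain h :: "'c \<Rightarrow> nat" where h: "inj_on h (range D)"
    using finite_imp_inj_to_nat_seg[OF fin] by metis
  show ?thesis
  proof (intro exI[of _ "\<lambda>x. h (D x)"] conjI allI impI)
    show "finite (range (\<lambda>x. h (D x)))"
      using finite_imageI[OF fin, of h] by (simp add: image_image)
    show "ef k A B ((\<lambda>i. (e i, f i)) ` {..<m})"
      if "h (D (A, e)) = h (D (B, f))" "e ` {..<m} \<subseteq> A" "f ` {..<m} \<subseteq> B" for A e B f
      using assms(1)[OF inj_onD[OF h that(1)] that(2,3)] by simp
  qed
qed

text \<open>The usual rank-\<open>k\<close> types. With no rounds left, record the atomic relations
  among the \<open>m\<close> marked points; otherwise, record which codes occur after marking one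
  more point. That is why \<open>m\<close> is arbitrary in the induction.\<close>

lemma finite_type_code:
  "\<exists>c :: (nat \<times> nat) set \<times> (nat \<Rightarrow> nat \<times> nat) \<Rightarrow> nat. finite (range c) \<and>
     (\<forall>A e B f. c (A, e) = c (B, f) \<longrightarrow> e ` {..<m} \<subseteq> A \<longrightarrow> f ` {..<m} \<subseteq> B \<longrightarrow>
        ef k A B ((\<lambda>i. (e i, f i)) ` {..<m}))"
proof (induction k arbitrary: m)
  case 0
  define D where "D = (\<lambda>(A :: (nat \<times> nat) set, e :: nat \<Rightarrow> nat \<times> nat).
    ({(i, j). i < m \<and> j < m \<and> e i = e j}, {(i, j). i < m \<and> j < m \<and> less_P (e i) (e j)},
     {(i, j). i < m \<and> j < m \<and> less_V (e i) (e j)}))"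
  have "range D \<subseteq> Pow ({..<m} \<times> {..<m}) \<times> Pow ({..<m} \<times> {..<m}) \<times> Pow ({..<m} \<times> {..<m})"
    by (auto simp: D_def)
  then have fin: "finite (range D)" by (rule finite_subset) auto
  have "partial_iso ((\<lambda>i. (e i, f i)) ` {..<m})" if "D (A, e) = D (B, f)" for A B e f
  proof -
    have D: "{(i, j). i < m \<and> j < m \<and> e i = e j} = {(i, j). i < m \<and> j < m \<and> f i = f j}"
        "{(i, j). i < m \<and> j < m \<and> less_P (e i) (e j)} = {(i, j). i < m \<and> j < m \<and> less_P (f i) (f j)}"
        "{(i, j). i < m \<and> j < m \<and> less_V (e i) (e j)} = {(i, j). i < m \<and> j < m \<and> less_V (f i) (f j)}"
      using that unfolding D_def by simp_all
    have "(e i = e j \<longleftrightarrow> f i = f j) \<and> (less_P (e i) (e j) \<longleftrightarrow> less_P (f i) (f j)) \<and>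
        (less_V (e i) (e j) \<longleftrightarrow> less_V (f i) (f j))" if "i < m" "j < m" for i j
      using that arg_cong[OF D(1), of "\<lambda>X. (i, j) \<in> X"] arg_cong[OF D(2), of "\<lambda>X. (i, j) \<in> X"]
        arg_cong[OF D(3), of "\<lambda>X. (i, j) \<in> X"] by simp
    note * = this
    show ?thesis
    proof (rule partial_isoI)
      fix a b a' b'
      assume "(a, b) \<in> (\<lambda>i. (e i, f i)) ` {..<m}" "(a', b') \<in> (\<lambda>i. (e i, f i)) ` {..<m}"
      then obtain i j where ij: "i < m" "j < m" and eq: "a = e i" "b = f i" "a' = e j" "b' = f j"
        by (elim imageE) blast
      show "(a = a' \<longleftrightarrow> b = b') \<and> (less_P a a' \<longleftrightarrow> less_P b b') \<and> (less_V a a' \<longleftrightarrow> less_V b b')"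
        using *[OF ij] unfolding eq .
    qed
  qed
  then have "ef 0 A B ((\<lambda>i. (e i, f i)) ` {..<m})"
    if "D (A, e) = D (B, f)" "e ` {..<m} \<subseteq> A" "f ` {..<m} \<subseteq> B" for A B e f
    using that by auto
  then show ?case using fin by (rule type_code_from_finite_range)
next
  case (Suc k)
  obtain c0 :: "(nat \<times> nat) set \<times> (nat \<Rightarrow> nat \<times> nat) \<Rightarrow> nat" where c0: "finite (range c0)"
    "\<And>A e B f. c0 (A, e) = c0 (B, f) \<Longrightarrow> e ` {..<m} \<subseteq> A \<Longrightarrow> f ` {..<m} \<subseteq> B \<Longrightarrow>
        ef k A B ((\<lambda>i. (e i, f i)) ` {..<m})" using Suc[of m] by blast
  obtain c1 :: "(nat \<times> nat) set \<times> (nat \<Rightarrow> nat \<times> nat) \<Rightarrow> nat" where c1: "finite (range c1)"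
    "\<And>A e B f. c1 (A, e) = c1 (B, f) \<Longrightarrow> e ` {..<Suc m} \<subseteq> A \<Longrightarrow> f ` {..<Suc m} \<subseteq> B \<Longrightarrow>
        ef k A B ((\<lambda>i. (e i, f i)) ` {..<Suc m})" using Suc[of "Suc m"] by blast
  \<comment> \<open>The set of codes of all one-point extensions provides the answers to both kinds
    of moves. The component from \<open>c0\<close> guarantees that the current position is already a
    partial isomorphism.\<close>
  define D where "D = (\<lambda>(A :: (nat \<times> nat) set, e). (c0 (A, e), (\<lambda>a. c1 (A, e(m := a))) ` A))"
  have "range D \<subseteq> range c0 \<times> Pow (range c1)" by (auto simp: D_def)
  then have fin: "finite (range D)" by (rule finite_subset) (use c0 c1 in auto)
  have "ef (Suc k) A B ((\<lambda>i. (e i, f i)) ` {..<m})" (is "ef _ _ _ ?R")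
    if D: "D (A, e) = D (B, f)" and e: "e ` {..<m} \<subseteq> A" and f: "f ` {..<m} \<subseteq> B" for A B e f
  proof -
    have 0: "ef k A B ?R" using c0(2)[OF _ e f] D by (simp add: D_def)
    have i: "ef k A B (insert (a, b) ?R)"
      if "a \<in> A" "b \<in> B" "c1 (A, e(m := a)) = c1 (B, f(m := b))" for a b
    proof -
      have "ef k A B ((\<lambda>i. ((e(m := a)) i, (f(m := b)) i)) ` {..<Suc m})"
        by (rule c1(2)[OF that(3)]) (use that e f in \<open>auto simp: lessThan_Suc\<close>)
      also have "(\<lambda>i. ((e(m := a)) i, (f(m := b)) i)) ` {..<Suc m} = insert (a, b) ?R"
        by (auto simp: lessThan_Suc)
      finally show ?thesis .
    qed
    have eq: "(\<lambda>a. c1 (A, e(m := a))) ` A = (\<lambda>b. c1 (B, f(m := b))) ` B"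
      using D by (simp add: D_def)
    have "\<exists>b\<in>B. ef k A B (insert (a, b) ?R)" if a: "a \<in> A" for a
    proof -
      have "c1 (A, e(m := a)) \<in> (\<lambda>b. c1 (B, f(m := b))) ` B" using a eq by blast
      then show ?thesis using i[OF a] by blast
    qed
    moreover have "\<exists>a\<in>A. ef k A B (insert (a, b) ?R)" if b: "b \<in> B" for b
    proof -
      have "c1 (B, f(m := b)) \<in> (\<lambda>a. c1 (A, e(m := a))) ` A" using b eq by blast
      then show ?thesis using i[OF _ b] by fastforce
    qed
    ultimately show ?thesis using ef_subset[OF 0] ef_partial_iso[OF 0] by simp
  qed
  then show ?case using fin by (rule type_code_from_finite_range)
qed

section \<open>The diagram of a tree\<close>

text \<open>\<open>Nd l r\<close> encodes the 231-avoiding permutation in which everything left of the maximum is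
  (order-isomorphic to) \<open>l\<close>, everything right of it is \<open>r\<close>; avoidance forces all values of \<open>l\<close>
  below all values of \<open>r\<close>.\<close>

fun dg :: "tr \<Rightarrow> (nat \<times> nat) set" where
  "dg Lf = {}"
| "dg (Nd l r) = dg l \<union> sh (size l) (size l) ` ({(1, size r + 1)} \<union> sh 1 0 ` dg r)"

text \<open>This is the direct sum of permutations: grafting \<open>s\<close> at the leftmost leaf
  of \<open>t\<close> puts its diagram below and to the left of that of \<open>t\<close>.\<close>

fun app :: "tr \<Rightarrow> tr \<Rightarrow> tr" where
  "app s Lf = s"
| "app s (Nd l r) = Nd (app s l) r"

lemma size_app [simp]: "size (app s t) = size s + size t"
  by (induction t) auto

lemma app_Lf [simp]: "app Lf t = t"
  by (induction t) auto

lemma app_assoc: "app (app s t) u = app s (app t u)"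
  by (induction u) auto

lemma dg_app: "dg (app s t) = dg s \<union> sh (size s) (size s) ` dg t"
  by (induction t) (auto simp: image_Un image_image Un_assoc)

lemma dg_bounds: "dg t \<subseteq> {1..size t} \<times> {1..size t}"
proof (induction t)
  case (Nd l r)
  then show ?case by (fastforce simp: sh_def)
qed simp

lemma dg_boundsD:
  assumes "a \<in> dg t"
  shows "1 \<le> fst a" "fst a \<le> size t" "1 \<le> snd a" "snd a \<le> size t"
  using dg_bounds[of t] assms by auto

section \<open>Game equivalence as a congruence on trees\<close>

definition teq :: "nat \<Rightarrow> tr \<Rightarrow> tr \<Rightarrow> bool" where
  "teq k s t \<longleftrightarrow> ef k (dg s) (dg t) {}"

lemma teq_refl [simp]: "teq k s s"
  unfolding teq_def by (rule ef_mono[OF ef_refl]) simp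

lemma teq_sym: "teq k s t \<Longrightarrow> teq k t s"
  unfolding teq_def using ef_sym[of k "dg s" "dg t" "{}"] by simp

lemma teq_trans: "teq k s t \<Longrightarrow> teq k t u \<Longrightarrow> teq k s u"
  unfolding teq_def using ef_trans[of k "dg s" "dg t" "{}" "dg u" "{}"] by simp

lemma uniform_sum: "uniform (dg s) (sh (size s) (size s) ` X) (dg s') (sh (size s') (size s') ` Y)"
  if "\<And>x. x \<in> X \<Longrightarrow> fst x > 0 \<and> snd x > 0" "\<And>y. y \<in> Y \<Longrightarrow> fst y > 0 \<and> snd y > 0"
proof -
  have *: "less_P a (sh (size s) (size s) x)" "less_V a (sh (size s) (size s) x)"
    "\<not> less_P (sh (size s) (size s) x) a" "\<not> less_V (sh (size s) (size s) x) a" "a \<noteq> sh (size s) (size s) x"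
    if "a \<in> dg s" "fst x > 0 \<and> snd x > 0" for a x s
    using dg_boundsD[OF that(1)] that(2) by (auto simp: less_P_def less_V_def sh_def)
  show ?thesis unfolding uniform_def using * that by auto
qed

text \<open>Stated for arbitrary positions because \<open>teq_tpow\<close> continues the game after
  a point of one summand has been played.\<close>

lemma ef_sum:
  assumes "ef k (dg s) (dg s') R" "ef k (dg t) (dg t') S"
  shows "ef k (dg (app s t)) (dg (app s' t'))
    (R \<union> map_prod (sh (size s) (size s)) (sh (size s') (size s')) ` S)"
proof -
  have "fst x > 0 \<and> snd x > 0" if "x \<in> dg u" for x u
    using dg_boundsD[OF that] by simp
  then show ?thesis
    unfolding dg_app by (intro ef_Un[OF uniform_sum assms(1) ef_sh[OF assms(2)]])
qed

lemma teq_app: "teq k s s' \<Longrightarrow> teq k t t' \<Longrightarrow> teq k (app s t) (app s' t')"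
  unfolding teq_def using ef_sum[of k s s' "{}" t t' "{}"] by simp

text \<open>The root is a single point to the left of and above the diagram of \<open>r\<close>, so
  the two can be glued. A left subtree is then supplied by \<open>app\<close>, since
  \<open>Nd l r\<close> is \<open>app l (Nd Lf r)\<close>.\<close>

lemma teq_Nd_Lf:
  assumes "teq k r r'"
  shows "teq k (Nd Lf r) (Nd Lf r')"
proof -
  have "ef k {(1::nat, 1::nat)} {(1, 1)} {}" by (rule ef_mono[OF ef_refl]) simp
  from ef_sh[OF this, of 0 "size r" 0 "size r'"]
  have 1: "ef k {(1, size r + 1)} {(1, size r' + 1)} {}" by (simp add: sh_def)
  have 2: "ef k (sh 1 0 ` dg r) (sh 1 0 ` dg r') {}"
    using ef_sh[OF assms[unfolded teq_def], of 1 0 1 0] by simp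
  have "uniform {(1, size r + 1)} (sh 1 0 ` dg r) {(1, size r' + 1)} (sh 1 0 ` dg r')"
  proof -
    have *: "less_P (1, size r + 1) (sh 1 0 a)" "\<not> less_V (1, size r + 1) (sh 1 0 a)"
      "\<not> less_P (sh 1 0 a) (1, size r + 1)" "less_V (sh 1 0 a) (1, size r + 1)"
      "(1, size r + 1) \<noteq> sh 1 0 a" if "a \<in> dg r" for a r
      using dg_boundsD[OF that] by (auto simp: less_P_def less_V_def sh_def)
    show ?thesis unfolding uniform_def using * by auto
  qed
  from ef_Un[OF this 1 2] show ?thesis by (simp add: teq_def)
qed

lemma teq_Nd:
  assumes "teq k l l'" "teq k r r'"
  shows "teq k (Nd l r) (Nd l' r')"
  using teq_app[OF assms(1) teq_Nd_Lf[OF assms(2)]] by simp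

lemma finite_teq_classes: "finite (range (\<lambda>t. {u. teq k t u}))"
proof -
  obtain c :: "(nat \<times> nat) set \<times> (nat \<Rightarrow> nat \<times> nat) \<Rightarrow> nat" where c: "finite (range c)"
    "\<And>A e B f. c (A, e) = c (B, f) \<Longrightarrow> ef k A B {}"
    using finite_type_code[of 0 k] by (simp add: all_conj_distrib) metis
  let ?e = "\<lambda>_ :: nat. undefined :: nat \<times> nat"
  have *: "teq k s t" if "c (dg s, ?e) = c (dg t, ?e)" for s t
    unfolding teq_def using c(2)[OF that] .
  \<comment> \<open>Equal codes imply equivalence, so a class is determined by the code of any
    member, and \<open>g\<close> recovers it from that code.\<close>
  define g where "g n = {u. \<exists>t. c (dg t, ?e) = n \<and> teq k t u}" for n
  have "{u. teq k t u} = g (c (dg t, ?e))" for t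
  proof (intro equalityI subsetI)
    fix u assume "u \<in> g (c (dg t, ?e))"
    then obtain t' where "c (dg t', ?e) = c (dg t, ?e)" "teq k t' u" unfolding g_def by blast
    then show "u \<in> {u. teq k t u}" using *[of t t'] teq_trans[of k t t' u] by simp
  qed (auto simp: g_def)
  then have "range (\<lambda>t. {u. teq k t u}) \<subseteq> g ` range c" by auto
  then show ?thesis using c(1) finite_subset by blast
qed

section \<open>Aperiodicity and the absorbing tree\<close>

fun tpow :: "tr \<Rightarrow> nat \<Rightarrow> tr" where
  "tpow x 0 = Lf"
| "tpow x (Suc m) = app x (tpow x m)"

lemma tpow_add: "tpow x (a + b) = app (tpow x a) (tpow x b)"
  by (induction a) (auto simp: app_assoc)

lemma in_dg_tpow:
  assumes "a \<in> dg (tpow x m)"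
  obtains j i a' where "m = j + Suc i" "a' \<in> dg x" "a = sh (size (tpow x j)) (size (tpow x j)) a'"
  using assms
proof (induction m arbitrary: a thesis)
  case (Suc m)
  then consider "a \<in> dg x" | b where "b \<in> dg (tpow x m)" "a = sh (size x) (size x) b"
    by (auto simp: dg_app)
  then show ?case
  proof cases
    case 1
    then show ?thesis using Suc.prems(1)[of 0 m a] by simp
  next
    case 2
    obtain j i a' where "m = j + Suc i" "a' \<in> dg x" "b = sh (size (tpow x j)) (size (tpow x j)) a'"
      using Suc.IH[OF _ 2(1)] by metis
    then show ?thesis using Suc.prems(1)[of "Suc j" i a'] 2 by simp
  qed
qed simp

text \<open>The value is 2^k - 1, the length beyond which \<open>k\<close> rounds cannot distinguish
  finite linear orders; here the elements are replaced by copies of a block.\<close>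

fun threshold :: "nat \<Rightarrow> nat" where
  "threshold 0 = 0"
| "threshold (Suc k) = 2 * threshold k + 1"

definition close :: "nat \<Rightarrow> nat \<Rightarrow> nat \<Rightarrow> bool" where
  "close k m m' \<longleftrightarrow> m = m' \<or> threshold k \<le> m \<and> threshold k \<le> m'"

lemma close_sym: "close k m m' \<Longrightarrow> close k m' m"
  by (auto simp: close_def)

text \<open>Choosing one block leaves \<open>j\<close> blocks before it and \<open>i\<close> after
  it. In a long power, a side shorter than the threshold is copied exactly; if both are long,
  \<open>threshold k\<close> blocks are left in front of the answer, and enough remain behind
  it.\<close>

lemma close_split:
  assumes "close (Suc k) (j + Suc i) m'"
  obtains j' i' where "m' = j' + Suc i'" "close k j j'" "close k i i'"
proof -
  let ?h = "threshold k"
  consider "j + Suc i = m'" | "2 * ?h + 1 \<le> j + Suc i" "2 * ?h + 1 \<le> m'"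
    using assms by (auto simp: close_def)
  then show ?thesis
  proof cases
    case 1
    then show ?thesis using that[of j i] by (auto simp: close_def)
  next
    case 2
    consider "j < ?h" | "?h \<le> j" "i < ?h" | "?h \<le> j" "?h \<le> i" by linarith
    then show ?thesis
    proof cases
      case 1
      then have "m' = j + Suc (m' - Suc j)" "close k i (m' - Suc j)" using 2 by (auto simp: close_def)
      then show ?thesis using that[of j "m' - Suc j"] by (auto simp: close_def)
    next
      case _: 2
      then have "m' = m' - Suc i + Suc i" "close k j (m' - Suc i)" using 2 by (auto simp: close_def)
      then show ?thesis using that[of "m' - Suc i" i] by (auto simp: close_def)
    next
      case 3
      then have "m' = ?h + Suc (m' - Suc ?h)" "close k i (m' - Suc ?h)" "close k j ?h"
        using 2 by (auto simp: close_def)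
      then show ?thesis using that[of ?h "m' - Suc ?h"] by blast
    qed
  qed
qed

text \<open>Aperiodicity. A point \<open>a'\<close> of one block is answered by the same point of
  the block given by \<open>close_split\<close>. The chosen blocks are then compared by the
  identity, the surroundings by induction.\<close>

lemma teq_tpow: "close k m m' \<Longrightarrow> teq k (tpow x m) (tpow x m')"
proof (induction k arbitrary: m m')
  case 0
  then show ?case by (simp add: teq_def partial_iso_def)
next
  case (Suc k)
  have forward: "\<exists>b\<in>dg (tpow x m'). ef k (dg (tpow x m)) (dg (tpow x m')) {(a, b)}"
    if c: "close (Suc k) m m'" and a: "a \<in> dg (tpow x m)" for m m' a
  proof -
    obtain j i a' where m: "m = j + Suc i" and a': "a' \<in> dg x"
      and a_eq: "a = sh (size (tpow x j)) (size (tpow x j)) a'" using in_dg_tpow[OF a] .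
    obtain j' i' where m': "m' = j' + Suc i'" and cj: "close k j j'" and ci: "close k i i'"
      using close_split[OF c[unfolded m]] .
    let ?b = "sh (size (tpow x j')) (size (tpow x j')) a'"
    have "ef k (dg x) (dg x) {(a', a')}"
      by (rule ef_mono[OF ef_refl]) (use a' in auto)
    from ef_sum[OF this Suc.IH[OF ci, unfolded teq_def]]
    have "ef k (dg (tpow x (Suc i))) (dg (tpow x (Suc i'))) {(a', a')}" by simp
    from ef_sum[OF Suc.IH[OF cj, unfolded teq_def] this]
    have ef: "ef k (dg (tpow x m)) (dg (tpow x m')) {(a, ?b)}"
      unfolding m m' tpow_add a_eq by simp
    then have "?b \<in> dg (tpow x m')" using ef_subset[OF ef] by simp
    with ef show ?thesis by blast
  qed
  have backward: "\<exists>a\<in>dg (tpow x m). ef k (dg (tpow x m)) (dg (tpow x m')) {(a, b)}"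
    if b: "b \<in> dg (tpow x m')" for b
  proof -
    obtain a where "a \<in> dg (tpow x m)" "ef k (dg (tpow x m')) (dg (tpow x m)) {(b, a)}"
      using forward[OF close_sym[OF Suc.prems] b] by blast
    moreover have "{(b, a)}\<inverse> = {(a, b)}" by auto
    ultimately show ?thesis using ef_sym[of k "dg (tpow x m')" "dg (tpow x m)" "{(b, a)}"] by auto
  qed
  show ?case
    unfolding teq_def using forward[OF Suc.prems] backward by (simp add: partial_iso_def)
qed

text \<open>Take \<open>e\<close> idempotent with as few classes \<open>e y e\<close> as possible. An idempotent power \<open>f\<close> of
  \<open>x = e y e\<close> has \<open>f S f = e S e\<close>, so \<open>e = f e f = f\<close> and \<open>x = f x = f\<close> by aperiodicity.\<close>

lemma absorbing_tree_exists:
  obtains e where "\<And>y. teq k (app e (app y e)) e"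
proof -
  define cls where "cls t = {u. teq k t u}" for t
  have cls: "cls s = cls t \<longleftrightarrow> teq k s t" for s t
    unfolding cls_def using teq_sym teq_trans teq_refl by blast
  define E where "E e = (\<lambda>y. cls (app e (app y e))) ` UNIV" for e
  have fin: "finite (E e)" for e
    by (rule finite_subset[OF _ finite_teq_classes[of k]]) (auto simp: E_def cls_def)
  have "teq k (app Lf Lf) Lf" by simp
  then obtain e where e: "teq k (app e e) e" and min: "\<And>f. teq k (app f f) f \<Longrightarrow> card (E e) \<le> card (E f)"
    using ex_has_least_nat[of "\<lambda>e. teq k (app e e) e" Lf "\<lambda>e. card (E e)"] by blast
  have "teq k (app e (app y e)) e" for y
  proof -
    define x where "x = app e (app y e)"
    have ex: "teq k (app e x) x"
      unfolding x_def using teq_app[OF e teq_refl[of k "app y e"]] by (simp add: app_assoc)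
    have xe: "teq k (app x e) x"
      unfolding x_def using teq_app[OF teq_refl[of k "app e y"] e] by (simp add: app_assoc)
    \<comment> \<open>All powers of \<open>x\<close> from the threshold on are equivalent, hence
      \<open>f\<close> is idempotent and absorbs \<open>x\<close>. The additional \<open>Suc\<close>
      makes the power nonempty, so that it begins and ends with \<open>x\<close> and therefore
      absorbs \<open>e\<close> on both sides.\<close>
    define N where "N = Suc (threshold k)"
    define f where "f = tpow x N"
    have ff: "teq k (app f f) f"
      unfolding f_def tpow_add[symmetric] by (rule teq_tpow) (simp add: close_def N_def)
    have xf: "teq k (app x f) f"
      unfolding f_def using teq_tpow[of k "Suc N" N x] by (simp add: close_def N_def)
    have fx: "teq k (app f x) f"
      unfolding f_def using teq_tpow[of k "N + 1" N x] unfolding tpow_add by (simp add: close_def N_def)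
    have ef: "teq k (app e f) f"
      unfolding f_def N_def using teq_app[OF ex teq_refl[of k "tpow x (threshold k)"]] by (simp add: app_assoc)
    have fe: "teq k (app f e) f"
    proof -
      have f: "f = app (tpow x (threshold k)) x"
        unfolding f_def N_def using tpow_add[of x "threshold k" 1] by simp
      show ?thesis unfolding f using teq_app[OF teq_refl[of k "tpow x (threshold k)"] xe] by (simp add: app_assoc)
    qed
    have "E f \<subseteq> E e"
    proof -
      have "cls (app f (app z f)) = cls (app e (app (app f (app z f)) e))" for z
        unfolding cls
      proof -
        have "teq k (app (app e f) (app z (app f e))) (app f (app z f))"
          by (intro teq_app teq_refl ef fe)
        then show "teq k (app f (app z f)) (app e (app (app f (app z f)) e))"
          by (simp add: app_assoc teq_sym)
      qed
      then show ?thesis unfolding E_def by blast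
    qed
    then have EE: "E f = E e" using card_seteq[OF fin _ min[OF ff]] by simp
    \<comment> \<open>As \<open>E f\<close> and \<open>E e\<close> agree, \<open>u\<close> is
      equivalent to some f z f, on which the idempotent \<open>f\<close> acts as a left identity.
      This is applied to \<open>x\<close> and to \<open>e\<close>.\<close>
    have in_f: "teq k (app f u) u" if "cls u \<in> E e" for u
    proof -
      have "cls u \<in> E f" using that EE by simp
      then obtain z where "cls u = cls (app f (app z f))" unfolding E_def by (elim imageE)
      then have u: "teq k u (app f (app z f))" by (simp add: cls)
      have "teq k (app f u) (app f (app f (app z f)))" using teq_app[OF teq_refl u] .
      moreover have "teq k (app f (app f (app z f))) (app f (app z f))"
        using teq_app[OF ff teq_refl[of k "app z f"]] by (simp add: app_assoc)
      ultimately show ?thesis using u teq_sym teq_trans by blast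
    qed
    have "cls x \<in> E e" unfolding E_def x_def by blast
    then have 1: "teq k x f" using in_f fx teq_sym teq_trans by blast
    have "teq k (app e (app Lf e)) e" using e by simp
    then have "cls e = cls (app e (app Lf e))" using cls teq_sym by blast
    then have "cls e \<in> E e" unfolding E_def by blast
    then have "teq k f e" using in_f fe teq_sym teq_trans by blast
    then show ?thesis using 1 teq_trans unfolding x_def by blast
  qed
  then show ?thesis using that by blast
qed

section \<open>Trees and 231-avoiding permutations\<close>

definition contains_231 :: "(nat \<times> nat) set \<Rightarrow> bool" where
  "contains_231 D \<longleftrightarrow> (\<exists>a\<in>D. \<exists>b\<in>D. \<exists>c\<in>D. fst a < fst b \<and> fst b < fst c \<and> snd c < snd a \<and> snd a < snd b)"

text \<open>An intrinsic description of the diagrams of \<open>Av231 n\<close>, where the images of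
  \<open>diagram n\<close> and \<open>dg\<close> meet.\<close>

definition good :: "nat \<Rightarrow> (nat \<times> nat) set \<Rightarrow> bool" where
  "good n D \<longleftrightarrow> fst ` D = {1..n} \<and> snd ` D = {1..n} \<and> inj_on fst D \<and> inj_on snd D \<and> \<not> contains_231 D"

lemma diagram_inj: "inj_on (diagram n) (Av231 n)"
proof (rule inj_onI)
  fix \<sigma> \<tau> assume s: "\<sigma> \<in> Av231 n" and t: "\<tau> \<in> Av231 n" and eq: "diagram n \<sigma> = diagram n \<tau>"
  show "\<sigma> = \<tau>"
  proof
    fix i
    show "\<sigma> i = \<tau> i"
    proof (cases "i \<in> {1..n}")
      case True
      then have "(i, \<sigma> i) \<in> diagram n \<tau>" unfolding eq[symmetric] by (auto simp: diagram_def)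
      then show ?thesis by (auto simp: diagram_def)
    next
      case False
      moreover have "\<sigma> permutes {1..n}" "\<tau> permutes {1..n}" using s t by (simp_all add: Av231_def)
      ultimately show ?thesis using permutes_not_in[of \<sigma>] permutes_not_in[of \<tau>] by metis
    qed
  qed
qed

lemma diagram_good:
  assumes "\<sigma> \<in> Av231 n"
  shows "good n (diagram n \<sigma>)"
proof -
  have p: "\<sigma> permutes {1..n}" and av: "avoids_231 n \<sigma>" using assms by (auto simp: Av231_def)
  have "snd ` diagram n \<sigma> = {1..n}"
    using permutes_image[OF p] by (simp add: diagram_def image_image)
  moreover have "fst ` diagram n \<sigma> = {1..n}" by (simp add: diagram_def image_image)
  moreover have "inj_on fst (diagram n \<sigma>)" by (auto simp: diagram_def inj_on_def)
  moreover have "inj_on snd (diagram n \<sigma>)"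
    using permutes_inj[OF p] by (auto simp: diagram_def inj_on_def)
  moreover have "\<not> contains_231 (diagram n \<sigma>)"
    using av by (auto simp: contains_231_def avoids_231_def diagram_def)
  ultimately show ?thesis by (simp add: good_def)
qed

lemma good_diagram:
  assumes "good n D"
  obtains \<sigma> where "\<sigma> \<in> Av231 n" "diagram n \<sigma> = D"
proof -
  have f: "fst ` D = {1..n}" and s: "snd ` D = {1..n}" and fi: "inj_on fst D" and si: "inj_on snd D"
    and av: "\<not> contains_231 D" using assms by (auto simp: good_def)
  define g where "g = the_inv_into D fst"
  have g: "g i \<in> D" "fst (g i) = i" if "i \<in> {1..n}" for i
    using that the_inv_into_into[OF fi] f_the_inv_into_f[OF fi] unfolding g_def f[symmetric] by auto
  have gf: "g (fst a) = a" if "a \<in> D" for a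
    unfolding g_def by (rule the_inv_into_f_f[OF fi that])
  define \<sigma> where "\<sigma> i = (if i \<in> {1..n} then snd (g i) else i)" for i
  have D: "diagram n \<sigma> = D"
  proof (intro equalityI subsetI)
    fix a assume "a \<in> diagram n \<sigma>"
    then obtain i where "i \<in> {1..n}" "a = (i, snd (g i))" by (auto simp: diagram_def \<sigma>_def)
    then have "a = g i" using g by (simp add: prod_eq_iff)
    then show "a \<in> D" using g \<open>i \<in> {1..n}\<close> by simp
  next
    fix a assume "a \<in> D"
    then have "fst a \<in> {1..n}" using f by auto
    then show "a \<in> diagram n \<sigma>"
      unfolding diagram_def using gf[OF \<open>a \<in> D\<close>]
      by (intro image_eqI[of _ _ "fst a"]) (auto simp: \<sigma>_def prod_eq_iff)
  qed
  have "\<sigma> permutes {1..n}"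
  proof (rule bij_imp_permutes)
    have "inj_on \<sigma> {1..n}"
    proof (rule inj_onI)
      fix i j assume ij: "i \<in> {1..n}" "j \<in> {1..n}" "\<sigma> i = \<sigma> j"
      then have "snd (g i) = snd (g j)" by (simp add: \<sigma>_def)
      then have "g i = g j" using inj_onD[OF si] g ij by blast
      then show "i = j" using g ij by metis
    qed
    moreover have "\<sigma> ` {1..n} = {1..n}"
      using s unfolding D[symmetric] by (simp add: diagram_def image_image)
    ultimately show "bij_betw \<sigma> {1..n} {1..n}" by (simp add: bij_betw_def)
  qed (auto simp: \<sigma>_def)
  moreover have "avoids_231 n \<sigma>"
    using av unfolding D[symmetric] by (auto simp: contains_231_def avoids_231_def diagram_def)
  ultimately show ?thesis using that D by (auto simp: Av231_def)
qed

lemma dg_Nd_cases: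
  assumes "a \<in> dg (Nd l r)"
  obtains (left) "a \<in> dg l" "1 \<le> fst a" "fst a \<le> size l" "1 \<le> snd a" "snd a \<le> size l"
    | (root) "fst a = size l + 1" "snd a = size l + size r + 1"
    | (right) b where "b \<in> dg r" "fst a = fst b + size l + 1" "snd a = snd b + size l"
        "1 \<le> fst b" "fst b \<le> size r" "1 \<le> snd b" "snd b \<le> size r"
proof -
  consider "a \<in> dg l" | "a = (size l + 1, size l + size r + 1)"
    | b where "b \<in> dg r" "a = (fst b + size l + 1, snd b + size l)"
    using assms by (auto simp: sh_def)
  then show ?thesis
  proof cases
    case 1
    then show ?thesis using left dg_boundsD[OF 1] by blast
  next
    case 2
    then show ?thesis using root by simp
  next
    case (3 b)
    then show ?thesis using right[OF 3(1)] dg_boundsD[OF 3(1)] by simp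
  qed
qed

text \<open>For avoidance, consider the first point of a possible 231. If it is in the left block,
  the smaller last point and then the middle one are there too; if it is the root, nothing lies
  above it; if it is in the right block, all three are.\<close>

lemma dg_good: "good (size t) (dg t)"
proof (induction t)
  case Lf
  then show ?case by (simp add: good_def contains_231_def)
next
  case (Nd l r)
  let ?n = "size (Nd l r)"
  have L: "fst ` dg l = {1..size l}" "snd ` dg l = {1..size l}" "inj_on fst (dg l)" "inj_on snd (dg l)"
    "\<not> contains_231 (dg l)" using Nd(1) by (auto simp: good_def)
  have R: "fst ` dg r = {1..size r}" "snd ` dg r = {1..size r}" "inj_on fst (dg r)" "inj_on snd (dg r)"
    "\<not> contains_231 (dg r)" using Nd(2) by (auto simp: good_def)
  have f: "fst ` dg (Nd l r) = fst ` dg l \<union> {size l + 1} \<union> (\<lambda>i. i + (size l + 1)) ` fst ` dg r"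
    by (auto simp: sh_def image_Un image_image)
  have s: "snd ` dg (Nd l r) = snd ` dg l \<union> {size l + size r + 1} \<union> (\<lambda>i. i + size l) ` snd ` dg r"
    by (auto simp: sh_def image_Un image_image)
  have "fst ` dg (Nd l r) = {1..?n}"
    unfolding f L R image_add_atLeastAtMost' by auto
  moreover have "snd ` dg (Nd l r) = {1..?n}"
    unfolding s L R image_add_atLeastAtMost' by auto
  moreover have "inj_on fst (dg (Nd l r))"
  proof (rule inj_onI)
    fix a b assume a: "a \<in> dg (Nd l r)" and b: "b \<in> dg (Nd l r)" and eq: "fst a = fst b"
    from a show "a = b"
    proof (cases rule: dg_Nd_cases)
      case left
      from b show ?thesis
        by (cases rule: dg_Nd_cases) (use left eq inj_onD[OF L(3), of a b] in auto)
    next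
      case root
      from b show ?thesis
        by (cases rule: dg_Nd_cases) (use root eq in \<open>auto simp: prod_eq_iff\<close>)
    next
      case (right a')
      from b show ?thesis
      proof (cases rule: dg_Nd_cases)
        case b': (right b')
        have "fst a' = fst b'" using right(2,3) b'(2,3) eq by linarith
        then have "a' = b'" using inj_onD[OF R(3)] right(1) b'(1) by blast
        then show ?thesis using right(2,3) b'(2,3) by (simp add: prod_eq_iff)
      qed (use right eq in auto)
    qed
  qed
  moreover have "inj_on snd (dg (Nd l r))"
  proof (rule inj_onI)
    fix a b assume a: "a \<in> dg (Nd l r)" and b: "b \<in> dg (Nd l r)" and eq: "snd a = snd b"
    from a show "a = b"
    proof (cases rule: dg_Nd_cases)
      case left
      from b show ?thesis
        by (cases rule: dg_Nd_cases) (use left eq inj_onD[OF L(4), of a b] in auto)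
    next
      case root
      from b show ?thesis
        by (cases rule: dg_Nd_cases) (use root eq in \<open>auto simp: prod_eq_iff\<close>)
    next
      case (right a')
      from b show ?thesis
      proof (cases rule: dg_Nd_cases)
        case b': (right b')
        have "snd a' = snd b'" using right(2,3) b'(2,3) eq by linarith
        then have "a' = b'" using inj_onD[OF R(4)] right(1) b'(1) by blast
        then show ?thesis using right(2,3) b'(2,3) by (simp add: prod_eq_iff)
      qed (use right eq in auto)
    qed
  qed
  moreover have "\<not> contains_231 (dg (Nd l r))"
  proof
    assume "contains_231 (dg (Nd l r))"
    then obtain a b c where abc: "a \<in> dg (Nd l r)" "b \<in> dg (Nd l r)" "c \<in> dg (Nd l r)"
      and ord: "fst a < fst b" "fst b < fst c" "snd c < snd a" "snd a < snd b"
      unfolding contains_231_def by blast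
    from abc(1) show False
    proof (cases rule: dg_Nd_cases)
      case left
      have c: "c \<in> dg l" "fst c \<le> size l" using abc(3)
        by (cases rule: dg_Nd_cases; use left ord in simp)+
      have "b \<in> dg l" using abc(2)
        by (cases rule: dg_Nd_cases) (use left c(2) ord in simp_all)
      then show False using L(5) left(1) c(1) ord unfolding contains_231_def by blast
    next
      case root
      from abc(2) show False by (cases rule: dg_Nd_cases) (use root ord in simp_all)
    next
      case (right a')
      obtain b' where b': "b' \<in> dg r" "fst b = fst b' + size l + 1" "snd b = snd b' + size l"
        using abc(2) by (cases rule: dg_Nd_cases) (use right ord in simp_all)
      obtain c' where c': "c' \<in> dg r" "fst c = fst c' + size l + 1" "snd c = snd c' + size l"
        using abc(3) by (cases rule: dg_Nd_cases) (use right ord b' in simp_all)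
      have "fst a' < fst b'" "fst b' < fst c'" "snd c' < snd a'" "snd a' < snd b'"
        using right b' c' ord by simp_all
      then show False using R(5) right(1) b'(1) c'(1) unfolding contains_231_def by blast
    qed
  qed
  ultimately show ?case unfolding good_def by blast
qed

lemma down_closed_eq:
  fixes X :: "nat set"
  assumes fin: "finite X" and pos: "\<And>x. x \<in> X \<Longrightarrow> x \<ge> 1"
    and dc: "\<And>u v. v \<in> X \<Longrightarrow> 1 \<le> u \<Longrightarrow> u \<le> v \<Longrightarrow> u \<in> X"
  shows "X = {1..card X}"
proof (cases "X = {}")
  case False
  have "X = {1..Max X}"
  proof (intro equalityI subsetI)
    fix u assume "u \<in> {1..Max X}"
    then show "u \<in> X" using dc[OF Max_in[OF fin False], of u] by simp
  next
    fix u assume "u \<in> X"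
    then show "u \<in> {1..Max X}" using pos[of u] Max_ge[OF fin, of u] by simp
  qed
  then show ?thesis by (metis card_atLeastAtMost diff_Suc_1)
qed simp

text \<open>Cut at the maximum \<open>m\<close>. Once the left values are known to lie below the
  right ones, both value sets are intervals, and the two parts are handled by induction.\<close>

lemma good_tree: "good n D \<Longrightarrow> \<exists>t. size t = n \<and> dg t = D"
proof (induction n arbitrary: D rule: less_induct)
  case (less n)
  have f: "fst ` D = {1..n}" and s: "snd ` D = {1..n}" and fi: "inj_on fst D" and si: "inj_on snd D"
    and av: "\<not> contains_231 D" using less.prems by (auto simp: good_def)
  show ?case
  proof (cases "n = 0")
    case True
    then show ?thesis using f by (intro exI[of _ Lf]) auto
  next
    case False
    then have "n \<in> snd ` D" using s by auto
    then obtain m where m: "m \<in> D" "snd m = n" by auto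
    have mf: "1 \<le> fst m" "fst m \<le> n" using f m(1) by auto
    have bd: "1 \<le> fst a" "fst a \<le> n" "1 \<le> snd a" "snd a \<le> n" if "a \<in> D" for a
    proof -
      have "fst a \<in> {1..n}" "snd a \<in> {1..n}" using that f s by blast+
      then show "1 \<le> fst a" "fst a \<le> n" "1 \<le> snd a" "snd a \<le> n" by auto
    qed
    have sn: "snd a < n" if "a \<in> D" "a \<noteq> m" for a
      using bd[OF that(1)] inj_onD[OF si, of a m] m that by (metis le_neq_implies_less)
    have fn: "fst a \<noteq> fst m" if "a \<in> D" "a \<noteq> m" for a
      using inj_onD[OF fi, of a m] m that by blast
    define l where "l = fst m - 1"
    define r where "r = n - fst m"
    have nlr: "n = l + r + 1" "fst m = l + 1" using mf by (auto simp: l_def r_def)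
    define L where "L = {a \<in> D. fst a < fst m}"
    define R where "R = {a \<in> D. fst m < fst a}"
    have DLR: "D = L \<union> {m} \<union> R" using m fn unfolding L_def R_def by (auto simp del: not_less) (metis nat_neq_iff)
    have finD: "finite D" using finite_imageD[OF _ fi] f by simp
    \<comment> \<open>Otherwise \<open>a\<close>, \<open>m\<close>, \<open>b\<close> would form a
      231.\<close>
    have LR: "snd a < snd b" if "a \<in> L" "b \<in> R" for a b
    proof (rule ccontr)
      assume "\<not> snd a < snd b"
      moreover have "snd a \<noteq> snd b" using inj_onD[OF si, of a b] that by (auto simp: L_def R_def)
      ultimately have "snd b < snd a" by simp
      moreover have "snd a < snd m" using sn[of a] that m by (auto simp: L_def)
      ultimately show False using av that m unfolding contains_231_def L_def R_def by blast
    qed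
    have fL: "fst ` L = {1..l}"
    proof -
      have "fst ` L = {i \<in> fst ` D. i < fst m}" unfolding L_def by auto
      then show ?thesis unfolding f nlr by auto
    qed
    have fR: "fst ` R = {l + 2..n}"
    proof -
      have "fst ` R = {i \<in> fst ` D. fst m < i}" unfolding R_def by auto
      then show ?thesis unfolding f nlr by auto
    qed
    have injL: "inj_on fst L" "inj_on snd L" and injR: "inj_on fst R" "inj_on snd R"
      using inj_on_subset[OF fi] inj_on_subset[OF si] by (auto simp: L_def R_def)
    have cL: "card L = l" using card_image[OF injL(1)] fL by simp
    have sL: "snd ` L = {1..l}"
    proof -
      have "snd ` L = {1..card (snd ` L)}"
      proof (rule down_closed_eq)
        show "finite (snd ` L)" using finD by (simp add: L_def)
        show "1 \<le> x" if "x \<in> snd ` L" for x using that bd by (auto simp: L_def)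
        fix u v assume v: "v \<in> snd ` L" and u: "1 \<le> u" "u \<le> v"
        obtain a where a: "a \<in> L" "v = snd a" using v by auto
        then have "u \<in> snd ` D" using u bd[of a] s by (auto simp: L_def)
        then obtain b where b: "b \<in> D" "u = snd b" by auto
        have "a \<in> D" "a \<noteq> m" using a by (auto simp: L_def)
        then have "b \<noteq> m" using sn[of a] a u b m by auto
        moreover have "b \<notin> R" using LR[of a b] a u b by auto
        ultimately show "u \<in> snd ` L" using b DLR by auto
      qed
      then show ?thesis using card_image[OF injL(2)] cL by simp
    qed
    have sR: "snd ` R = {l + 1..<n}"
    proof -
      have "snd ` D = snd ` L \<union> {n} \<union> snd ` R" using m by (subst DLR) auto
      moreover have "snd ` L \<inter> snd ` R = {}" using LR by fastforce
      moreover have "n \<notin> snd ` R" using sn by (auto simp: R_def)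
      ultimately have "snd ` R = {1..n} - {1..l} - {n}" unfolding s sL by blast
      then show ?thesis using nlr by auto
    qed
    \<comment> \<open>Undoes the shift of the right block. Positions drop by one more than values
      because the root takes a position before the block but no value below it.\<close>
    define g where "g a = (fst a - (l + 1), snd a - l)" for a :: "nat \<times> nat"
    have Rb: "l + 2 \<le> fst a" "l + 1 \<le> snd a" if "a \<in> R" for a
      using that fR sR by (metis atLeastAtMost_iff atLeastLessThan_iff image_eqI)+
    have shg: "sh (l + 1) l (g a) = a" if "a \<in> R" for a
      using Rb[OF that] by (simp add: g_def sh_def prod_eq_iff)
    have "good l L"
      using fL sL injL av unfolding good_def contains_231_def L_def by blast
    then obtain tl where tl: "size tl = l" "dg tl = L" using less.IH[of l L] nlr by auto
    have "good r (g ` R)"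
    proof -
      have "fst ` g ` R = (\<lambda>i. i - (l + 1)) ` fst ` R" by (simp add: g_def image_image)
      also have "\<dots> = {1..r}"
      proof -
        have "{l + 2..n} = (\<lambda>i. i + (l + 1)) ` {1..r}"
          unfolding image_add_atLeastAtMost' using nlr(1)
          by (intro set_eqI) (simp only: atLeastAtMost_iff atLeastLessThan_iff, linarith)
        then show ?thesis unfolding fR by (simp only: image_image add_diff_cancel_right' image_ident)
      qed
      finally have 1: "fst ` g ` R = {1..r}" .
      have "snd ` g ` R = (\<lambda>i. i - l) ` snd ` R" by (simp add: g_def image_image)
      also have "\<dots> = {1..r}"
      proof -
        have "{l + 1..<n} = (\<lambda>i. i + l) ` {1..r}"
          unfolding image_add_atLeastAtMost' using nlr(1)
          by (intro set_eqI) (simp only: atLeastAtMost_iff atLeastLessThan_iff, linarith)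
        then show ?thesis unfolding sR by (simp only: image_image add_diff_cancel_right' image_ident)
      qed
      finally have 2: "snd ` g ` R = {1..r}" .
      have le: "fst (g a) < fst (g b) \<longleftrightarrow> fst a < fst b" "snd (g a) < snd (g b) \<longleftrightarrow> snd a < snd b"
        "fst (g a) = fst (g b) \<longleftrightarrow> fst a = fst b" "snd (g a) = snd (g b) \<longleftrightarrow> snd a = snd b"
        if "a \<in> R" "b \<in> R" for a b
        unfolding g_def fst_conv snd_conv using Rb[OF that(1)] Rb[OF that(2)] by linarith+
      have 3: "inj_on fst (g ` R)" "inj_on snd (g ` R)"
      proof -
        show "inj_on fst (g ` R)"
        proof (rule inj_onI; elim imageE)
          fix u v a b assume "fst u = fst v" "u = g a" "a \<in> R" "v = g b" "b \<in> R"
          then show "u = v" using le(3)[of a b] inj_onD[OF injR(1), of a b] by simp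
        qed
        show "inj_on snd (g ` R)"
        proof (rule inj_onI; elim imageE)
          fix u v a b assume "snd u = snd v" "u = g a" "a \<in> R" "v = g b" "b \<in> R"
          then show "u = v" using le(4)[of a b] inj_onD[OF injR(2), of a b] by simp
        qed
      qed
      have "\<not> contains_231 R" using av unfolding contains_231_def R_def by blast
      then have "\<not> contains_231 (g ` R)" unfolding contains_231_def by (simp add: le)
      then show ?thesis using 1 2 3 by (simp add: good_def)
    qed
    then obtain tr where tr: "size tr = r" "dg tr = g ` R" using less.IH[of r "g ` R"] nlr by auto
    have "sh (l + 1) l ` g ` R = R" using shg by (force simp: image_image)
    then have "sh l l ` sh 1 0 ` g ` R = R" by (simp add: image_image)
    moreover have "m = sh l l (1, r + 1)" using nlr m by (simp add: sh_def prod_eq_iff)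
    ultimately have "dg (Nd tl tr) = D" unfolding DLR using tl tr by auto
    then show ?thesis using tl tr nlr by (intro exI[of _ "Nd tl tr"]) auto
  qed
qed

lemma size_eq_card_dg: "size t = card (dg t)"
  using dg_good[of t] card_image[of fst "dg t"] by (simp add: good_def)

lemma dg_Nd_left: "dg l = {a \<in> dg (Nd l r). fst a \<le> size l}"
  using dg_boundsD[of _ l] by (auto simp: sh_def)

lemma dg_Nd_right: "dg r = {a. 1 \<le> fst a \<and> sh (size l + 1) (size l) a \<in> dg (Nd l r)}"
proof (intro equalityI subsetI)
  fix a assume "a \<in> dg r"
  then have "sh (size l) (size l) (sh 1 0 a) \<in> dg (Nd l r)" "1 \<le> fst a"
    using dg_boundsD(1) by (auto simp del: sh_sh)
  then show "a \<in> {a. 1 \<le> fst a \<and> sh (size l + 1) (size l) a \<in> dg (Nd l r)}" by simp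
next
  fix a assume "a \<in> {a. 1 \<le> fst a \<and> sh (size l + 1) (size l) a \<in> dg (Nd l r)}"
  then have "1 \<le> fst a" "sh (size l + 1) (size l) a \<in> dg (Nd l r)" by auto
  from this(2) show "a \<in> dg r"
  proof (cases rule: dg_Nd_cases)
    case (right b)
    then have "a = b" by (simp add: sh_def prod_eq_iff)
    then show ?thesis using right by simp
  qed (use \<open>1 \<le> fst a\<close> in \<open>auto simp: sh_def\<close>)
qed

lemma dg_Nd_root: "(i, size (Nd l r)) \<in> dg (Nd l r) \<longleftrightarrow> i = size l + 1"
proof
  assume "(i, size (Nd l r)) \<in> dg (Nd l r)"
  then show "i = size l + 1"
    by (cases rule: dg_Nd_cases) auto
qed (simp add: sh_def)

text \<open>The position of the largest value reveals the size of the left subtree, and from this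
  size the diagrams of both subtrees can be cut out.\<close>

lemma inj_dg: "dg s = dg t \<Longrightarrow> s = t"
proof (induction s arbitrary: t)
  case Lf
  then show ?case using size_eq_card_dg[of t] by (cases t) auto
next
  case (Nd l r)
  have sz: "size t = size (Nd l r)" using Nd.prems size_eq_card_dg by metis
  then obtain l' r' where t: "t = Nd l' r'" by (cases t) auto
  have "(size l + 1, size (Nd l r)) \<in> dg (Nd l' r')"
    using Nd.prems dg_Nd_root[of _ l r] unfolding t by simp
  then have l: "size l = size l'" using dg_Nd_root[of _ l' r'] sz unfolding t by simp
  have "dg l = dg l'" unfolding dg_Nd_left[of l r] dg_Nd_left[of l' r'] Nd.prems[unfolded t] l ..
  moreover have "dg r = dg r'" unfolding dg_Nd_right[of r l] dg_Nd_right[of r' l'] Nd.prems[unfolded t] l ..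
  ultimately show ?case using Nd.IH t by blast
qed

section \<open>From random permutations to proportions of trees\<close>

definition sat_tr :: "too_formula \<Rightarrow> tr set" where
  "sat_tr \<Psi> = {t. satisfies (dg t) less_P less_V (\<lambda>_. undefined) \<Psi>}"

definition prop_tr :: "tr set \<Rightarrow> nat \<Rightarrow> real" where
  "prop_tr S n = real (card (S \<inter> trees n)) / real (cat n)"

text \<open>Satisfaction depends on the diagram alone, and trees of size \<open>n\<close> and
  permutations in \<open>Av231 n\<close> have the same diagrams, each exactly once.\<close>

lemma sat_prob_eq: "sat_prob \<Psi> n = prop_tr (sat_tr \<Psi>) n"
proof -
  have im: "dg ` trees n = diagram n ` Av231 n"
  proof (intro equalityI subsetI)
    fix D assume "D \<in> dg ` trees n"
    then have "good n D" using dg_good by (auto simp: trees_def)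
    then show "D \<in> diagram n ` Av231 n" using good_diagram by (metis image_eqI)
  next
    fix D assume "D \<in> diagram n ` Av231 n"
    then have "good n D" using diagram_good by blast
    then show "D \<in> dg ` trees n" using good_tree[of n D] by (auto simp: trees_def)
  qed
  have inj: "inj_on dg A" for A by (intro inj_onI) (rule inj_dg)
  let ?P = "\<lambda>D. satisfies D less_P less_V (\<lambda>_. undefined) \<Psi>"
  have "card (Av231 n) = card (diagram n ` Av231 n)" by (rule card_image[OF diagram_inj, symmetric])
  also have "\<dots> = cat n" unfolding im[symmetric] cat_def by (rule card_image[OF inj])
  finally have 1: "card (Av231 n) = cat n" .
  have "card (Av231 n \<inter> {\<sigma>. models n \<sigma> \<Psi>}) = card (diagram n ` (Av231 n \<inter> {\<sigma>. models n \<sigma> \<Psi>}))"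
    by (rule card_image[symmetric]) (rule inj_on_subset[OF diagram_inj], simp)
  also have "diagram n ` (Av231 n \<inter> {\<sigma>. models n \<sigma> \<Psi>}) = {D \<in> diagram n ` Av231 n. ?P D}"
    by (auto simp: models_def)
  also have "\<dots> = dg ` (sat_tr \<Psi> \<inter> trees n)"
    unfolding im[symmetric] sat_tr_def by auto
  also have "card \<dots> = card (sat_tr \<Psi> \<inter> trees n)" by (rule card_image[OF inj])
  finally have 2: "card (Av231 n \<inter> {\<sigma>. models n \<sigma> \<Psi>}) = card (sat_tr \<Psi> \<inter> trees n)" .
  show ?thesis
    unfolding sat_prob_def random_Av231_def prop_tr_def
    by (subst measure_pmf_of_set) (auto simp: Av231_nonempty finite_Av231 1 2)
qed

lemma sat_tr_invariant:
  assumes "sentence \<Psi>" "teq (qdepth \<Psi>) s t"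
  shows "s \<in> sat_tr \<Psi> \<longleftrightarrow> t \<in> sat_tr \<Psi>"
  using ef_satisfies[OF assms(2)[unfolded teq_def], of \<Psi>] assms(1)
  by (simp add: sat_tr_def sentence_def)

section \<open>Convergence\<close>

fun plug1 :: "bool \<times> tr \<Rightarrow> tr \<Rightarrow> tr" where
  "plug1 (True, x) t = Nd x t"
| "plug1 (False, x) t = Nd t x"

lemma step_cases:
  obtains x where "g = (True, x)" | x where "g = (False, x)"
proof (cases g)
  case (Pair b x)
  then show ?thesis using that by (cases b) auto
qed

definition plug :: "(bool \<times> tr) list \<Rightarrow> tr \<Rightarrow> tr" where
  "plug h t = foldr plug1 h t"

definition gsize :: "bool \<times> tr \<Rightarrow> nat" where
  "gsize g = Suc (size (snd g))"

lemma plug_simps [simp]: "plug [] t = t" "plug (g # h) t = plug1 g (plug h t)"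
  by (simp_all add: plug_def)

lemma plug_append: "plug (h @ h') t = plug h (plug h' t)"
  by (simp add: plug_def)

lemma size_plug1: "size (plug1 g t) = gsize g + size t"
  by (cases g rule: step_cases) (auto simp: gsize_def)

lemma size_plug: "size (plug h t) = sum_list (map gsize h) + size t"
  by (induction h) (auto simp: size_plug1)

lemma plug1_inj: "plug1 g s = plug1 g t \<Longrightarrow> s = t"
  by (cases g rule: step_cases) auto

lemma plug_inj: "plug h s = plug h t \<Longrightarrow> s = t"
  by (induction h) (auto dest: plug1_inj)

lemma teq_plug1: "teq k s t \<Longrightarrow> teq k (plug1 g s) (plug1 g t)"
  by (cases g rule: step_cases) (auto intro: teq_Nd)

lemma teq_plug: "teq k s t \<Longrightarrow> teq k (plug h s) (plug h t)"
  by (induction h) (auto intro: teq_plug1)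

text \<open>The context is the path to the leftmost leaf of \<open>t\<close>, with the right
  subtrees along it.\<close>

lemma app_as_plug: "\<exists>h. \<forall>s. app s t = plug h s"
proof (induction t)
  case Lf
  show ?case by (rule exI[of _ "[]"]) simp
next
  case (Nd l r)
  then obtain h where "\<forall>s. app s l = plug h s" by blast
  then show ?case by (intro exI[of _ "(False, r) # h"]) simp
qed

text \<open>Any tree between two copies of \<open>e\<close> is absorbed, so the hole is put into the
  middle factor, as the right subtree of \<open>Nd Lf t\<close>.\<close>

lemma constant_context_exists:
  obtains e h where "\<And>t. teq k (plug h t) e"
proof -
  obtain e where e: "\<And>y. teq k (app e (app y e)) e" using absorbing_tree_exists[of k] by blast
  obtain h where h: "\<And>s. app s e = plug h s" using app_as_plug[of e] by blast
  have "plug (h @ [(True, e)]) t = app e (app (Nd Lf t) e)" for t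
    by (simp add: plug_append h[symmetric] app_assoc[symmetric])
  then show ?thesis using that[of "h @ [(True, e)]" e] e by metis
qed

lemma prop_tr_nonneg: "0 \<le> prop_tr S n"
  by (simp add: prop_tr_def)

lemma prop_tr_le_1: "prop_tr S n \<le> 1"
proof -
  have "card (S \<inter> trees n) \<le> cat n" unfolding cat_def by (rule card_mono) auto
  then show ?thesis using cat_pos[of n] by (simp add: prop_tr_def)
qed

section \<open>Decomposition at the root\<close>

definition small_steps :: "nat \<Rightarrow> (bool \<times> tr) set" where
  "small_steps J = UNIV \<times> {x. size x < J}"

lemma small_trees: "{x. size x < J} = (\<Union>l<J. trees l)"
  by (auto simp: trees_def)

lemma finite_small_steps [simp]: "finite (small_steps J)"
  unfolding small_steps_def small_trees by auto

text \<open>Each side of the root contributes 1/2 minus a tail, so in the limit almost all trees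
  have exactly one small root subtree.\<close>

lemma sum_small_steps: "(\<Sum>g\<in>small_steps J. (1/4::real) ^ gsize g) = 1 - 2 * tail_wt J"
proof -
  have "(\<Sum>x\<in>{x::tr. size x < J}. (1/4::real) ^ Suc (size x)) = (\<Sum>l<J. \<Sum>x\<in>trees l. (1/4) ^ Suc (size x))"
    unfolding small_trees by (subst sum.UNION_disjoint) (auto, auto simp: trees_def)
  also have "\<dots> = (\<Sum>l<J. wt l)"
  proof (rule sum.cong[OF refl])
    fix l
    have "(\<Sum>x\<in>trees l. (1/4::real) ^ Suc (size x)) = (\<Sum>x\<in>trees l. (1/4) ^ Suc l)"
      by (rule sum.cong) (auto simp: trees_def)
    then show "(\<Sum>x\<in>trees l. (1/4::real) ^ Suc (size x)) = wt l"
      by (simp add: wt_def cat_def power_one_over)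
  qed
  finally have 1: "(\<Sum>x\<in>{x::tr. size x < J}. (1/4::real) ^ Suc (size x)) = 1/2 - tail_wt J"
    by (simp add: sum_wt)
  have "(\<Sum>g\<in>small_steps J. (1/4::real) ^ gsize g) = (\<Sum>b\<in>(UNIV :: bool set). \<Sum>x\<in>{x::tr. size x < J}. (1/4) ^ Suc (size x))"
    unfolding small_steps_def by (subst sum.cartesian_product) (simp add: gsize_def case_prod_beta)
  then show ?thesis unfolding 1 by (simp add: UNIV_bool)
qed

lemma card_plug1_image:
  "card (S \<inter> plug1 g ` trees m) = card ((plug1 g -` S) \<inter> trees m)"
proof -
  have "S \<inter> plug1 g ` trees m = plug1 g ` ((plug1 g -` S) \<inter> trees m)" by auto
  then show ?thesis
    by (simp add: card_image inj_on_def) (metis card_image inj_onI plug1_inj)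
qed

text \<open>The bound on \<open>n\<close> prevents both root subtrees from having size below
  \<open>J\<close>, so a tree arises from at most one small step.\<close>

lemma plug1_disjoint:
  assumes "n \<ge> 2 * J + 1" "g \<in> small_steps J" "g' \<in> small_steps J" "g \<noteq> g'"
  shows "plug1 g ` trees (n - gsize g) \<inter> plug1 g' ` trees (n - gsize g') = {}"
proof (rule ccontr)
  assume "\<not> ?thesis"
  then obtain s s' where s: "size s = n - gsize g" "size s' = n - gsize g'" "plug1 g s = plug1 g' s'"
    by (auto simp: trees_def)
  have J: "size (snd g) < J" "size (snd g') < J" using assms by (auto simp: small_steps_def)
  show False
  proof (cases g rule: step_cases)
    case g: (1 x)
    show False
    proof (cases g' rule: step_cases)
      case (1 y)
      then show False using g s(3) assms(4) by simp
    next
      case (2 y)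
      then have "x = s'" using g s(3) by simp
      then show False using g 2 s J assms(1) by (simp add: gsize_def)
    qed
  next
    case g: (2 x)
    show False
    proof (cases g' rule: step_cases)
      case (1 y)
      then have "x = s'" using g s(3) by simp
      then show False using g 1 s J assms(1) by (simp add: gsize_def)
    next
      case (2 y)
      then show False using g s(3) assms(4) by simp
    qed
  qed
qed

text \<open>The remainder \<open>e\<close> comes from trees whose root subtrees both have size at
  least \<open>J\<close>, and is at most their total proportion.\<close>

lemma prop_tr_decomposition:
  assumes n: "n \<ge> 2 * J + 1"
  defines "\<alpha> \<equiv> \<lambda>g. real (cat (n - gsize g)) / real (cat n)"
  shows "\<exists>e. prop_tr S n = (\<Sum>g\<in>small_steps J. \<alpha> g * prop_tr (plug1 g -` S) (n - gsize g)) + e \<and>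
    0 \<le> e \<and> e \<le> 1 - (\<Sum>g\<in>small_steps J. \<alpha> g)"
proof -
  define Z where "Z g = plug1 g ` trees (n - gsize g)" for g
  define W where "W = trees n - (\<Union>g\<in>small_steps J. Z g)"
  have sub: "Z g \<subseteq> trees n" if "g \<in> small_steps J" for g
    using that n unfolding Z_def by (auto simp: trees_def size_plug1 small_steps_def gsize_def)
  have fin: "finite (Z g)" for g by (simp add: Z_def)
  have count: "card (S \<inter> trees n) = (\<Sum>g\<in>small_steps J. card ((plug1 g -` S) \<inter> trees (n - gsize g))) + card (S \<inter> W)" for S
  proof -
    have "S \<inter> trees n = (\<Union>g\<in>small_steps J. S \<inter> Z g) \<union> (S \<inter> W)"
      using sub unfolding W_def by blast
    also have "card \<dots> = card (\<Union>g\<in>small_steps J. S \<inter> Z g) + card (S \<inter> W)"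
      by (rule card_Un_disjoint) (auto simp: W_def fin)
    also have "card (\<Union>g\<in>small_steps J. S \<inter> Z g) = (\<Sum>g\<in>small_steps J. card (S \<inter> Z g))"
    proof (rule card_UN_disjoint)
      show "\<forall>g\<in>small_steps J. \<forall>g'\<in>small_steps J. g \<noteq> g' \<longrightarrow> S \<inter> Z g \<inter> (S \<inter> Z g') = {}"
        using plug1_disjoint[OF n] unfolding Z_def by blast
    qed (auto simp: fin)
    finally show ?thesis unfolding Z_def card_plug1_image .
  qed
  define e where "e = real (card (S \<inter> W)) / real (cat n)"
  have "prop_tr S n = (\<Sum>g\<in>small_steps J. \<alpha> g * prop_tr (plug1 g -` S) (n - gsize g)) + e"
  proof -
    have "\<alpha> g * prop_tr (plug1 g -` S) (n - gsize g) = real (card ((plug1 g -` S) \<inter> trees (n - gsize g))) / real (cat n)" for g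
      using cat_pos[of "n - gsize g"] by (simp add: \<alpha>_def prop_tr_def)
    then show ?thesis
      unfolding prop_tr_def[of S] count e_def by (simp add: add_divide_distrib sum_divide_distrib)
  qed
  moreover have "0 \<le> e" by (simp add: e_def)
  moreover have "e \<le> 1 - (\<Sum>g\<in>small_steps J. \<alpha> g)"
  proof -
    have "card (S \<inter> W) \<le> card W" by (rule card_mono) (auto simp: W_def)
    \<comment> \<open>Counting all trees in the same way gives the size of the exceptional
      set.\<close>
    moreover have "cat n = (\<Sum>g\<in>small_steps J. cat (n - gsize g)) + card W"
      using count[of UNIV] by (simp add: cat_def)
    then have "real (card W) = real (cat n) - (\<Sum>g\<in>small_steps J. real (cat (n - gsize g)))" by simp
    ultimately have "e \<le> (real (cat n) - (\<Sum>g\<in>small_steps J. real (cat (n - gsize g)))) / real (cat n)"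
      unfolding e_def by (intro divide_right_mono) auto
    also have "\<dots> = 1 - (\<Sum>g\<in>small_steps J. \<alpha> g)"
      using cat_pos[of n] by (simp add: \<alpha>_def diff_divide_distrib sum_divide_distrib)
    finally show ?thesis .
  qed
  ultimately show ?thesis by blast
qed

section \<open>Contraction of the oscillation\<close>

text \<open>Controls the limit superior minus the limit inferior of the proportions. As
  \<open>n\<close> and \<open>m\<close> may be exchanged, no absolute value appears.\<close>

definition osc_le :: "tr set \<Rightarrow> real \<Rightarrow> bool" where
  "osc_le S d \<longleftrightarrow> (\<exists>N. \<forall>n\<ge>N. \<forall>m\<ge>N. prop_tr S n - prop_tr S m \<le> d)"

text \<open>The oscillation is bounded by a weighted average in which \<open>g0\<close> has the
  better value \<open>d0\<close>. The term \<open>\<epsilon>\<close> pays for trees with two large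
  root subtrees and for replacing the ratios by their limits.\<close>

lemma osc_le_step:
  assumes d: "\<And>g. osc_le (plug1 g -` S) d" and g0: "osc_le (plug1 g0 -` S) d0"
    and d0: "d \<ge> 0" and eps: "\<epsilon> > 0"
  shows "osc_le S ((1/4) ^ gsize g0 * d0 + (1 - (1/4) ^ gsize g0) * d + \<epsilon>)"
proof -
  have "(\<lambda>J. 2 * tail_wt J) \<longlonglongrightarrow> 2 * 0" by (intro tendsto_intros tail_wt_tendsto_0)
  then have "eventually (\<lambda>J. 2 * tail_wt J < \<epsilon> / 2) sequentially"
    using eps by (intro order_tendstoD(2)[where y = "2 * 0"]) auto
  then have "eventually (\<lambda>J. 2 * tail_wt J < \<epsilon> / 2 \<and> size (snd g0) < J) sequentially"
    using eventually_gt_at_top by (rule eventually_conj)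
  then obtain J where J: "2 * tail_wt J < \<epsilon> / 2" "size (snd g0) < J"
    by (auto simp: eventually_sequentially)
  let ?G = "small_steps J"
  let ?w = "\<lambda>g. (1/4::real) ^ gsize g"
  define \<alpha> where "\<alpha> n g = real (cat (n - gsize g)) / real (cat n)" for n g
  have g0G: "g0 \<in> ?G" using J by (cases g0) (auto simp: small_steps_def)
  \<comment> \<open>Both errors together. The limit of \<open>u\<close> is the mass missed by the
    small steps, which is below half of \<open>\<epsilon>\<close> by the choice of
    \<open>J\<close>.\<close>
  define u where "u n = (\<Sum>g\<in>?G. \<bar>\<alpha> n g - ?w g\<bar>) + (1 - (\<Sum>g\<in>?G. \<alpha> n g))" for n
  have "u \<longlonglongrightarrow> (\<Sum>g\<in>?G. \<bar>?w g - ?w g\<bar>) + (1 - (\<Sum>g\<in>?G. ?w g))"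
    unfolding u_def \<alpha>_def by (intro tendsto_intros cat_ratio_shift)
  then have "u \<longlonglongrightarrow> 2 * tail_wt J" by (simp add: sum_small_steps)
  then have "eventually (\<lambda>n. u n < \<epsilon> / 2) sequentially" using J(1) by (rule order_tendstoD(2))
  then obtain N0 where N0: "\<And>n. n \<ge> N0 \<Longrightarrow> u n < \<epsilon> / 2" by (auto simp: eventually_sequentially)
  define D where "D g = (if g = g0 then d0 else d)" for g
  have "\<exists>N. \<forall>n\<ge>N. \<forall>m\<ge>N. prop_tr (plug1 g -` S) n - prop_tr (plug1 g -` S) m \<le> D g" for g
    using d g0 unfolding D_def osc_le_def by auto
  then obtain M where M: "\<And>g n m. n \<ge> M g \<Longrightarrow> m \<ge> M g \<Longrightarrow>
      prop_tr (plug1 g -` S) n - prop_tr (plug1 g -` S) m \<le> D g" by metis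
  \<comment> \<open>The sum dominates every \<open>M g + gsize g\<close>, so the bound for
    \<open>g\<close> still applies after \<open>gsize g\<close> has been subtracted.\<close>
  define N where "N = max N0 (2 * J + 1) + (\<Sum>g\<in>?G. M g + gsize g)"
  have NM: "M g \<le> n - gsize g" if "n \<ge> N" "g \<in> ?G" for n g
  proof -
    have "M g + gsize g \<le> (\<Sum>g\<in>?G. M g + gsize g)"
      by (rule member_le_sum) (use that in auto)
    then show ?thesis using that by (simp add: N_def)
  qed
  have sumD: "(\<Sum>g\<in>?G. ?w g * D g) \<le> ?w g0 * d0 + (1 - ?w g0) * d"
  proof -
    have "(\<Sum>g\<in>?G. ?w g * D g) = ?w g0 * d0 + (\<Sum>g\<in>?G - {g0}. ?w g * d)"
      by (subst sum.remove[OF _ g0G]) (auto simp: D_def intro: sum.cong)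
    also have "(\<Sum>g\<in>?G - {g0}. ?w g * d) = (1 - 2 * tail_wt J - ?w g0) * d"
      unfolding sum_distrib_right[symmetric] using sum.remove[OF finite_small_steps g0G, of ?w]
      by (simp add: sum_small_steps)
    also have "\<dots> \<le> (1 - ?w g0) * d"
      using tail_wt_nonneg[of J] d0 by (intro mult_right_mono) auto
    finally show ?thesis by simp
  qed
  have "prop_tr S n - prop_tr S m \<le> ?w g0 * d0 + (1 - ?w g0) * d + \<epsilon>" if n: "n \<ge> N" and m: "m \<ge> N" for n m
  proof -
    let ?p = "\<lambda>n g. prop_tr (plug1 g -` S) (n - gsize g)"
    have nJ: "n \<ge> 2 * J + 1" "m \<ge> 2 * J + 1" "n \<ge> N0" "m \<ge> N0" using n m by (auto simp: N_def)
    obtain e where e: "prop_tr S n = (\<Sum>g\<in>?G. \<alpha> n g * ?p n g) + e" "e \<le> 1 - (\<Sum>g\<in>?G. \<alpha> n g)"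
      using prop_tr_decomposition[OF nJ(1), of S] unfolding \<alpha>_def by blast
    obtain e' where e': "prop_tr S m = (\<Sum>g\<in>?G. \<alpha> m g * ?p m g) + e'" "0 \<le> e'" "e' \<le> 1 - (\<Sum>g\<in>?G. \<alpha> m g)"
      using prop_tr_decomposition[OF nJ(2), of S] unfolding \<alpha>_def by blast
    \<comment> \<open>Insert the limiting weight into both products; proportions are at most 1, so
      each replacement costs at most the error in the weight.\<close>
    have termwise: "\<alpha> n g * ?p n g - \<alpha> m g * ?p m g \<le> ?w g * D g + \<bar>\<alpha> n g - ?w g\<bar> + \<bar>\<alpha> m g - ?w g\<bar>"
      if g: "g \<in> ?G" for g
    proof -
      have le_abs: "x * prop_tr S' n' \<le> \<bar>x\<bar>" for x S' n'
      proof -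
        have "x * prop_tr S' n' \<le> \<bar>x\<bar> * prop_tr S' n'"
          by (intro mult_right_mono prop_tr_nonneg) simp
        also have "\<dots> \<le> \<bar>x\<bar> * 1" by (intro mult_left_mono prop_tr_le_1) simp
        finally show ?thesis by simp
      qed
      have "(\<alpha> n g - ?w g) * ?p n g \<le> \<bar>\<alpha> n g - ?w g\<bar>"
        using le_abs .
      moreover have "(?w g - \<alpha> m g) * ?p m g \<le> \<bar>\<alpha> m g - ?w g\<bar>"
        using le_abs[of "?w g - \<alpha> m g"] by (simp add: abs_minus_commute)
      moreover have "?w g * (?p n g - ?p m g) \<le> ?w g * D g"
        by (rule mult_left_mono[OF M[OF NM[OF n g] NM[OF m g]]]) simp
      ultimately show ?thesis by (simp add: algebra_simps)
    qed
    have "prop_tr S n - prop_tr S m \<le> (\<Sum>g\<in>?G. \<alpha> n g * ?p n g - \<alpha> m g * ?p m g) + (1 - (\<Sum>g\<in>?G. \<alpha> n g))"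
      using e e' by (simp add: sum_subtractf)
    also have "(\<Sum>g\<in>?G. \<alpha> n g * ?p n g - \<alpha> m g * ?p m g)
        \<le> (\<Sum>g\<in>?G. ?w g * D g + \<bar>\<alpha> n g - ?w g\<bar> + \<bar>\<alpha> m g - ?w g\<bar>)"
      by (rule sum_mono[OF termwise])
    also have "\<dots> = (\<Sum>g\<in>?G. ?w g * D g) + (\<Sum>g\<in>?G. \<bar>\<alpha> n g - ?w g\<bar>) + (\<Sum>g\<in>?G. \<bar>\<alpha> m g - ?w g\<bar>)"
      by (simp add: sum.distrib)
    finally have "prop_tr S n - prop_tr S m \<le> (\<Sum>g\<in>?G. ?w g * D g) + u n + (\<Sum>g\<in>?G. \<bar>\<alpha> m g - ?w g\<bar>)"
      by (simp add: u_def)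
    moreover have "(\<Sum>g\<in>?G. \<bar>\<alpha> m g - ?w g\<bar>) \<le> u m" using e' by (simp add: u_def)
    ultimately show ?thesis using N0[OF nJ(3)] N0[OF nJ(4)] sumD by linarith
  qed
  then show ?thesis unfolding osc_le_def by blast
qed

lemma osc_le_mono: "osc_le S d \<Longrightarrow> d \<le> d' \<Longrightarrow> osc_le S d'"
  unfolding osc_le_def by (meson order_trans)

lemma osc_le_trivial: "osc_le UNIV 0" "osc_le {} 0"
proof -
  have "prop_tr UNIV n = 1" for n using cat_pos[of n] by (simp add: prop_tr_def flip: cat_def)
  then show "osc_le UNIV 0" by (simp add: osc_le_def)
qed (simp add: osc_le_def prop_tr_def)

definition inv_set :: "nat \<Rightarrow> tr set \<Rightarrow> bool" where
  "inv_set k S \<longleftrightarrow> (\<forall>s t. teq k s t \<longrightarrow> (s \<in> S \<longleftrightarrow> t \<in> S))"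

lemma inv_set_plug1: "inv_set k S \<Longrightarrow> inv_set k (plug1 g -` S)"
  unfolding inv_set_def using teq_plug1 by blast

text \<open>At the hole the set is trivial and its oscillation is 0. Going back to the root, each
  step mixes this gain with the general bound \<open>d\<close>, so the gain is multiplied by the
  weight of every step of \<open>h\<close>.\<close>

lemma osc_le_context:
  assumes d: "\<And>S. inv_set k S \<Longrightarrow> osc_le S d" "d \<ge> 0"
  shows "inv_set k S \<Longrightarrow> plug h -` S \<in> {UNIV, {}} \<Longrightarrow> \<epsilon> > 0 \<Longrightarrow>
    osc_le S ((1 - (1/4) ^ sum_list (map gsize h)) * d + \<epsilon>)"
proof (induction h arbitrary: S \<epsilon>)
  case Nil
  then have "S = UNIV \<or> S = {}" by (simp add: vimage_def)
  then show ?case using osc_le_trivial Nil by (auto intro: osc_le_mono)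
next
  case (Cons g h)
  let ?w = "(1/4::real) ^ gsize g" and ?v = "(1/4::real) ^ sum_list (map gsize h)"
  have inv: "inv_set k (plug1 g' -` S)" for g' using inv_set_plug1[OF Cons.prems(1)] .
  have "plug h -` (plug1 g -` S) = plug (g # h) -` S" by auto
  then have "osc_le (plug1 g -` S) ((1 - ?v) * d + \<epsilon> / 2)"
    using Cons.prems by (intro Cons.IH[OF inv]) auto
  from osc_le_step[OF d(1)[OF inv] this d(2), of "\<epsilon> / 2"] Cons.prems
  have "osc_le S (?w * ((1 - ?v) * d + \<epsilon> / 2) + (1 - ?w) * d + \<epsilon> / 2)" by simp
  moreover have "?w * ((1 - ?v) * d + \<epsilon> / 2) + (1 - ?w) * d + \<epsilon> / 2 \<le> (1 - ?w * ?v) * d + \<epsilon>"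
  proof -
    have "?w * (\<epsilon> / 2) \<le> 1 * (\<epsilon> / 2)"
      using Cons.prems by (intro mult_right_mono power_le_one) auto
    then show ?thesis by (simp add: algebra_simps)
  qed
  ultimately show ?case by (auto simp: power_add intro: osc_le_mono)
qed

text \<open>One context \<open>h\<close> serves all invariant sets, so the improved bound again
  holds for all of them and the contraction can be iterated.\<close>

lemma inv_set_convergent:
  assumes "inv_set k S"
  shows "convergent (prop_tr S)"
proof -
  obtain e h where eh: "\<And>t. teq k (plug h t) e" using constant_context_exists[of k] by blast
  have triv: "plug h -` S \<in> {UNIV, {}}" if "inv_set k S" for S
    using that eh unfolding inv_set_def by blast
  define \<delta> where "\<delta> = (1/4::real) ^ sum_list (map gsize h)"
  have \<delta>: "0 < \<delta>" "\<delta> \<le> 1" by (auto simp: \<delta>_def intro: power_le_one)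
  have osc: "osc_le S ((1 - \<delta> / 2) ^ j)" if "inv_set k S" for j S
    using that
  proof (induction j arbitrary: S)
    case 0
    have "prop_tr S n - prop_tr S m \<le> 1" for n m
      using prop_tr_le_1[of S n] prop_tr_nonneg[of S m] by simp
    then show ?case by (simp add: osc_le_def)
  next
    case (Suc j)
    let ?d = "(1 - \<delta> / 2) ^ j"
    have d: "?d > 0" using \<delta> by simp
    \<comment> \<open>Half of the gain is spent on the error term, hence the contraction factor
      \<open>1 - \<delta> / 2\<close>.\<close>
    have "osc_le S ((1 - \<delta>) * ?d + \<delta> / 2 * ?d)"
      using osc_le_context[of k ?d S h "\<delta> / 2 * ?d", OF Suc.IH _ Suc.prems triv[OF Suc.prems]] d \<delta>
      unfolding \<delta>_def[symmetric] by simp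
    then show ?case by (simp add: algebra_simps)
  qed
  have "Cauchy (prop_tr S)"
  proof (rule metric_CauchyI)
    fix \<epsilon> :: real assume "\<epsilon> > 0"
    have "(\<lambda>j. (1 - \<delta> / 2) ^ j) \<longlonglongrightarrow> 0" by (rule LIMSEQ_realpow_zero) (use \<delta> in auto)
    then have "eventually (\<lambda>j. (1 - \<delta> / 2) ^ j < \<epsilon>) sequentially"
      using \<open>\<epsilon> > 0\<close> by (rule order_tendstoD(2))
    then obtain j where j: "(1 - \<delta> / 2) ^ j < \<epsilon>" by (auto simp: eventually_sequentially)
    obtain N where N: "\<And>n m. n \<ge> N \<Longrightarrow> m \<ge> N \<Longrightarrow> prop_tr S n - prop_tr S m \<le> (1 - \<delta> / 2) ^ j"
      using osc[OF assms, of j] unfolding osc_le_def by blast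
    show "\<exists>M. \<forall>m\<ge>M. \<forall>n\<ge>M. dist (prop_tr S m) (prop_tr S n) < \<epsilon>"
    proof (intro exI allI impI)
      fix m n assume "m \<ge> N" "n \<ge> N"
      then show "dist (prop_tr S m) (prop_tr S n) < \<epsilon>"
        using N[of m n] N[of n m] j by (auto simp: dist_real_def abs_if)
    qed
  qed
  then show ?thesis by (rule Cauchy_convergent)
qed

lemma sat_prob_convergent:
  assumes "sentence \<Psi>"
  shows "convergent (sat_prob \<Psi>)"
proof -
  have "sat_prob \<Psi> = prop_tr (sat_tr \<Psi>)" using sat_prob_eq by blast
  then show ?thesis
    using inv_set_convergent[of "qdepth \<Psi>" "sat_tr \<Psi>"] sat_tr_invariant[OF assms]
    by (simp add: inv_set_def)
qed

section \<open>Positive limits and exponential decay\<close>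

fun avoids_sub :: "tr \<Rightarrow> tr \<Rightarrow> bool" where
  "avoids_sub e Lf \<longleftrightarrow> e \<noteq> Lf"
| "avoids_sub e (Nd l r) \<longleftrightarrow> e \<noteq> Nd l r \<and> avoids_sub e l \<and> avoids_sub e r"

lemma not_avoids_sub_plug: "\<not> avoids_sub e t \<Longrightarrow> \<exists>c. t = plug c e"
proof (induction t)
  case Lf
  then show ?case by (intro exI[of _ "[]"]) simp
next
  case (Nd l r)
  then consider "e = Nd l r" | c where "l = plug c e" | c where "r = plug c e" by auto
  then show ?case
  proof cases
    case 1
    then show ?thesis by (intro exI[of _ "[]"]) simp
  next
    case (2 c)
    then show ?thesis by (intro exI[of _ "(False, r) # c"]) simp
  next
    case (3 c)
    then show ?thesis by (intro exI[of _ "(True, l) # c"]) simp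
  qed
qed

lemma avoids_sub_smaller: "size t < size e \<Longrightarrow> avoids_sub e t"
  by (induction t) auto

lemma not_avoids_sub_Lf: "\<not> avoids_sub Lf t"
  by (induction t) auto

definition avcount :: "tr \<Rightarrow> nat \<Rightarrow> nat" where
  "avcount e n = card {t \<in> trees n. avoids_sub e t}"

lemma avcount_le_cat: "avcount e n \<le> cat n"
  unfolding avcount_def cat_def by (rule card_mono) auto

text \<open>Two avoiding subtrees form an avoiding tree or \<open>e\<close> itself, because a tree
  too small to be \<open>e\<close> avoids it. The correction removes that single exception.\<close>

lemma avcount_Suc:
  "avcount e (Suc n) + (if size e = Suc n then 1 else 0) = (\<Sum>i\<le>n. avcount e i * avcount e (n - i))"
proof -
  let ?A = "\<lambda>n. {t \<in> trees n. avoids_sub e t}"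
  let ?U = "\<Union>i\<le>n. case_prod Nd ` (?A i \<times> ?A (n - i))"
  have "?U = {t \<in> trees (Suc n). avoids_sub e t \<or> t = e}"
  proof (intro equalityI subsetI)
    fix t assume "t \<in> ?U"
    then show "t \<in> {t \<in> trees (Suc n). avoids_sub e t \<or> t = e}" by (auto simp: trees_def)
  next
    fix t assume t: "t \<in> {t \<in> trees (Suc n). avoids_sub e t \<or> t = e}"
    then obtain l r where lr: "t = Nd l r" "size l + size r = n"
      by (cases t) (auto simp: trees_def)
    have "avoids_sub e l" "avoids_sub e r"
      using t lr avoids_sub_smaller[of l e] avoids_sub_smaller[of r e] by auto
    then have "(l, r) \<in> ?A (size l) \<times> ?A (n - size l)" "size l \<le> n" using lr by (auto simp: trees_def)
    then show "t \<in> ?U" using lr(1) by force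
  qed
  moreover have "card {t \<in> trees (Suc n). avoids_sub e t \<or> t = e} = avcount e (Suc n) + (if size e = Suc n then 1 else 0)"
  proof (cases "size e = Suc n")
    case True
    have "\<not> avoids_sub e e" by (cases e) auto
    moreover have "{t \<in> trees (Suc n). avoids_sub e t \<or> t = e} = insert e (?A (Suc n))"
      using True by (auto simp: trees_def)
    ultimately show ?thesis using True by (simp add: avcount_def)
  next
    case False
    then have "{t \<in> trees (Suc n). avoids_sub e t \<or> t = e} = ?A (Suc n)" by (auto simp: trees_def)
    then show ?thesis using False by (simp add: avcount_def)
  qed
  moreover have "card ?U = (\<Sum>i\<le>n. card (case_prod Nd ` (?A i \<times> ?A (n - i))))"
    by (rule card_UN_disjoint) (auto, auto simp: trees_def)
  moreover have "card (case_prod Nd ` (?A i \<times> ?A (n - i))) = avcount e i * avcount e (n - i)" for i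
    by (subst card_image) (auto simp: inj_on_def avcount_def card_cartesian_product)
  ultimately show ?thesis by simp
qed

lemma convolution_le_square:
  fixes f :: "nat \<Rightarrow> real"
  assumes "\<And>i. f i \<ge> 0"
  shows "(\<Sum>n\<le>N. \<Sum>i\<le>n. f i * f (n - i)) \<le> (\<Sum>n\<le>N. f n)\<^sup>2"
proof -
  have "(\<Sum>n\<le>N. \<Sum>i\<le>n. f i * f (n - i)) = (\<Sum>(i, j)\<in>{(i, j). i + j \<le> N}. f i * f j)"
    by (rule sum.triangle_reindex_eq[symmetric])
  also have "\<dots> \<le> (\<Sum>(i, j)\<in>{..N} \<times> {..N}. f i * f j)"
    by (rule sum_mono2) (auto simp: assms)
  also have "\<dots> = (\<Sum>n\<le>N. f n)\<^sup>2"
    by (simp add: power2_eq_square sum_product sum.cartesian_product)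
  finally show ?thesis .
qed

text \<open>At 1/4 both inequalities are strict: the Catalan series sums to 2 there, its truncation
  to less, and the first expression is 2 - (1/4)^m. By continuity they survive slightly to the right
  of 1/4.\<close>

lemma good_radius_exists:
  obtains x :: real where "x > 1/4" "1 + 4 * x - x ^ m \<le> 2" "(\<Sum>n\<le>m. real (cat n) * x ^ n) \<le> 2"
proof -
  define F where "F x = 1 + 4 * x - x ^ m" for x :: real
  define G where "G x = (\<Sum>n\<le>m. real (cat n) * x ^ n)" for x :: real
  have "F (1/4) < 2" by (simp add: F_def)
  moreover have "G (1/4) < 2"
  proof -
    have "G (1/4) = (\<Sum>l<Suc m. 4 * wt l)"
      unfolding G_def lessThan_Suc_atMost by (intro sum.cong refl) (simp add: wt_def power_one_over)
    also have "\<dots> = 2 - 4 * tail_wt (Suc m)"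
      unfolding sum_distrib_left[symmetric] sum_wt by simp
    finally show ?thesis using wt_le_tail[of m] wt_pos[of m] by linarith
  qed
  moreover have "(F \<longlongrightarrow> F (1/4)) (at_right (1/4))" "(G \<longlongrightarrow> G (1/4)) (at_right (1/4))"
    unfolding F_def G_def by (auto intro!: tendsto_eq_intros)
  ultimately have "eventually (\<lambda>x. F x < 2) (at_right (1/4))" "eventually (\<lambda>x. G x < 2) (at_right (1/4))"
    by (auto intro: order_tendstoD)
  then have "eventually (\<lambda>x. F x < 2 \<and> G x < 2 \<and> x > 1/4) (at_right (1/4))"
    using eventually_at_right_less[of "1/4::real"] by (intro eventually_conj)
  then obtain x where "F x < 2" "G x < 2" "x > 1/4"
    using eventually_happens trivial_limit_at_right_real by blast
  then show ?thesis using that unfolding F_def G_def by force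
qed

text \<open>Partial sums of the generating function at \<open>x\<close> stay below 2. Up to
  \<open>size e\<close> they are compared with the Catalan sum; afterwards the recursion turns the
  bound 2 into 1 + 4 x - x^m, which is again at most 2.\<close>

lemma avcount_exponential:
  obtains x :: real where "x > 1/4" "\<And>n. real (avcount e n) * x ^ n \<le> 2"
proof -
  let ?m = "size e"
  obtain x :: real where x: "x > 1/4" "1 + 4 * x - x ^ ?m \<le> 2" "(\<Sum>n\<le>?m. real (cat n) * x ^ n) \<le> 2"
    using good_radius_exists[of ?m] .
  define f where "f n = real (avcount e n) * x ^ n" for n
  have f0: "f n \<ge> 0" for n using x by (simp add: f_def)
  have bound: "(\<Sum>n\<le>N. f n) \<le> 2" for N
  proof (induction N)
    case 0
    have "f 0 \<le> 1" using avcount_le_cat[of e 0] by (simp add: f_def cat_0)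
    then show ?case by simp
  next
    case (Suc N)
    show ?case
    proof (cases "Suc N \<le> ?m")
      case True
      have "(\<Sum>n\<le>Suc N. f n) \<le> (\<Sum>n\<le>?m. f n)" by (rule sum_mono2) (use True f0 in auto)
      also have "\<dots> \<le> (\<Sum>n\<le>?m. real (cat n) * x ^ n)"
        unfolding f_def using x avcount_le_cat by (intro sum_mono mult_right_mono) auto
      finally show ?thesis using x by simp
    next
      case False
      show ?thesis
      proof (cases "?m = 0")
        case True
        then have "e = Lf" by (cases e) auto
        then have "f n = 0" for n by (simp add: f_def avcount_def not_avoids_sub_Lf)
        then show ?thesis by simp
      next
        case m: False
        have step: "f (Suc n) = x * (\<Sum>i\<le>n. f i * f (n - i)) - (if ?m = Suc n then x ^ ?m else 0)" for n
        proof -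
          have "real (avcount e (Suc n)) = (\<Sum>i\<le>n. real (avcount e i) * real (avcount e (n - i))) - (if ?m = Suc n then 1 else 0)"
            using arg_cong[OF avcount_Suc[of e n], of real] by (auto split: if_splits)
          moreover have "(\<Sum>i\<le>n. f i * f (n - i)) = x ^ n * (\<Sum>i\<le>n. real (avcount e i) * real (avcount e (n - i)))"
            unfolding sum_distrib_left f_def
            by (intro sum.cong refl) (simp add: algebra_simps flip: power_add)
          ultimately have "(\<Sum>i\<le>n. f i * f (n - i)) = x ^ n * (real (avcount e (Suc n)) + (if ?m = Suc n then 1 else 0))"
            by simp
          then show ?thesis by (auto simp: f_def[of "Suc n"] algebra_simps)
        qed
        have "(\<Sum>n\<le>Suc N. f n) = f 0 + (\<Sum>n\<le>N. f (Suc n))" by (rule sum.atMost_Suc_shift)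
        also have "(\<Sum>n\<le>N. f (Suc n)) = x * (\<Sum>n\<le>N. \<Sum>i\<le>n. f i * f (n - i)) - (\<Sum>n\<le>N. if ?m = Suc n then x ^ ?m else 0)"
          unfolding step by (simp add: sum_subtractf sum_distrib_left)
        \<comment> \<open>The correction occurs exactly once, since \<open>size e\<close> is now
          between 1 and \<open>N\<close>.\<close>
        also have "(\<Sum>n\<le>N. if ?m = Suc n then x ^ ?m else 0) = x ^ ?m"
        proof -
          have "(\<Sum>n\<le>N. if ?m = Suc n then x ^ ?m else 0) = (\<Sum>n\<le>N. if n = ?m - 1 then x ^ ?m else 0)"
            using m by (intro sum.cong refl) auto
          then show ?thesis using False by simp
        qed
        also have "x * (\<Sum>n\<le>N. \<Sum>i\<le>n. f i * f (n - i)) \<le> x * 2\<^sup>2"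
        proof -
          have "(\<Sum>n\<le>N. \<Sum>i\<le>n. f i * f (n - i)) \<le> (\<Sum>n\<le>N. f n)\<^sup>2"
            by (rule convolution_le_square[OF f0])
          also have "\<dots> \<le> 2\<^sup>2" by (intro power_mono Suc.IH sum_nonneg f0)
          finally show ?thesis using x by (intro mult_left_mono) auto
        qed
        finally have "(\<Sum>n\<le>Suc N. f n) \<le> f 0 + (x * 2\<^sup>2 - x ^ ?m)" by simp
        moreover have "f 0 \<le> 1" using avcount_le_cat[of e 0] by (simp add: f_def cat_0)
        ultimately show ?thesis using x(2) by simp
      qed
    qed
  qed
  have "f n \<le> 2" for n
  proof -
    have "f n \<le> (\<Sum>n\<le>n. f n)" by (rule member_le_sum) (auto simp: f0)
    then show ?thesis using bound[of n] by simp
  qed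
  then show ?thesis using that x(1) unfolding f_def by blast
qed

lemma avoiding_exponentially_rare:
  assumes "\<And>t. t \<in> S \<Longrightarrow> avoids_sub e t"
  obtains \<epsilon> :: real where "0 < \<epsilon>" "\<epsilon> < 1" "prop_tr S \<in> O(\<lambda>n. \<epsilon> ^ n)"
proof -
  obtain x :: real where x: "x > 1/4" "\<And>n. real (avcount e n) * x ^ n \<le> 2"
    using avcount_exponential[of e] by blast
  define q where "q = 1 / (4 * x)"
  have q: "0 < q" "q < 1" using x by (auto simp: q_def)
  have le: "prop_tr S n \<le> 2 * (real n + 1)\<^sup>2 * q ^ n" for n
  proof -
    have "card (S \<inter> trees n) \<le> avcount e n"
      unfolding avcount_def by (rule card_mono) (use assms in auto)
    then have "prop_tr S n \<le> real (avcount e n) / real (cat n)"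
      unfolding prop_tr_def by (intro divide_right_mono) auto
    also have "\<dots> \<le> (2 / x ^ n) / real (cat n)"
      using x by (intro divide_right_mono) (auto simp: pos_le_divide_eq)
    also have "\<dots> \<le> (2 / x ^ n) * ((real n + 1)\<^sup>2 / 4 ^ n)"
    proof -
      have "1 / real (cat n) \<le> (real n + 1)\<^sup>2 / 4 ^ n"
        using cat_lower[of n] cat_pos[of n] by (simp add: field_simps)
      then have "(2 / x ^ n) * (1 / real (cat n)) \<le> (2 / x ^ n) * ((real n + 1)\<^sup>2 / 4 ^ n)"
        using x by (intro mult_left_mono) auto
      then show ?thesis by simp
    qed
    also have "\<dots> = 2 * (real n + 1)\<^sup>2 * q ^ n"
      by (simp add: q_def power_divide power_mult_distrib)
    finally show ?thesis .
  qed
  \<comment> \<open>Any rate strictly between \<open>q\<close> and 1 absorbs the polynomial factor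
    from \<open>cat_lower\<close>.\<close>
  define \<epsilon> where "\<epsilon> = (1 + q) / 2"
  have eps: "0 < \<epsilon>" "\<epsilon> < 1" "q < \<epsilon>" using q by (auto simp: \<epsilon>_def)
  have "(\<lambda>n. 2 * (real n + 1)\<^sup>2 * q ^ n) \<in> O(\<lambda>n. \<epsilon> ^ n)"
    using q eps by real_asymp
  moreover have "prop_tr S \<in> O(\<lambda>n. 2 * (real n + 1)\<^sup>2 * q ^ n)"
  proof (rule landau_o.big_mono, rule always_eventually, rule allI)
    fix n
    have "2 * (real n + 1)\<^sup>2 * q ^ n \<ge> 0" using q by simp
    then show "norm (prop_tr S n) \<le> norm (2 * (real n + 1)\<^sup>2 * q ^ n)"
      using le[of n] prop_tr_nonneg[of S n] by simp
  qed
  ultimately have "prop_tr S \<in> O(\<lambda>n. \<epsilon> ^ n)" using landau_o.big_trans by blast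
  then show ?thesis using that eps by blast
qed

text \<open>Filling \<open>c\<close> is injective, so the limit is at least 1/4 to the power of the
  size of \<open>c\<close>.\<close>

lemma prop_tr_context_lower:
  assumes "\<And>t. plug c t \<in> S" "prop_tr S \<longlonglongrightarrow> L"
  shows "L > 0"
proof -
  let ?M = "sum_list (map gsize c)"
  have "eventually (\<lambda>n. real (cat (n - ?M)) / real (cat n) \<le> prop_tr S n) sequentially"
  proof (rule eventually_sequentiallyI[of ?M])
    fix n assume n: "n \<ge> ?M"
    have "cat (n - ?M) = card (plug c ` trees (n - ?M))"
      unfolding cat_def by (rule card_image[symmetric]) (auto intro: inj_onI dest: plug_inj)
    also have "\<dots> \<le> card (S \<inter> trees n)"
      by (rule card_mono) (use assms(1) n in \<open>auto simp: trees_def[of n] trees_def[of "n - ?M"] size_plug finite_trees[unfolded trees_def]\<close>)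
    finally show "real (cat (n - ?M)) / real (cat n) \<le> prop_tr S n"
      unfolding prop_tr_def by (intro divide_right_mono) auto
  qed
  then have "(1/4) ^ ?M \<le> L"
    using tendsto_le[OF _ assms(2) cat_ratio_shift[of ?M]] by simp
  moreover have "(0::real) < (1/4) ^ ?M" by simp
  ultimately show ?thesis by linarith
qed

lemma zero_or_positive:
  assumes "inv_set k S"
  shows "lim (prop_tr S) > 0 \<or> (\<exists>\<epsilon>::real. 0 < \<epsilon> \<and> \<epsilon> < 1 \<and> prop_tr S \<in> O(\<lambda>n. \<epsilon> ^ n))"
proof -
  obtain e h where eh: "\<And>t. teq k (plug h t) e" using constant_context_exists[of k] by blast
  show ?thesis
  proof (cases "\<exists>c. plug c e \<in> S")
    case True
    then obtain c where c: "plug c e \<in> S" by blast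
    \<comment> \<open>Replacing \<open>e\<close> inside \<open>c\<close> by the equivalent tree
      \<open>plug h t\<close> does not leave \<open>S\<close>.\<close>
    have "plug (c @ h) t \<in> S" for t
      using c teq_plug[OF eh[of t], of c] assms unfolding inv_set_def plug_append by blast
    moreover have "prop_tr S \<longlonglongrightarrow> lim (prop_tr S)"
      using inv_set_convergent[OF assms] convergent_LIMSEQ_iff by blast
    ultimately show ?thesis using prop_tr_context_lower by blast
  next
    case False
    then have "avoids_sub e t" if "t \<in> S" for t using not_avoids_sub_plug[of e t] that by blast
    then show ?thesis using avoiding_exponentially_rare[of S e] by blast
  qed
qed

section \<open>Density of the limits\<close>

text \<open>A chain of \<open>l\<close> elements, each before the previous one, starting at
  \<open>v\<close>. Every quantifier takes the next index, which avoids capture; the trivial base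
  keeps \<open>v\<close> free.\<close>

fun before :: "nat \<Rightarrow> nat \<Rightarrow> too_formula" where
  "before 0 v = Eq v v"
| "before (Suc l) v = Exists (Suc v) (Conj (LessP (Suc v) v) (before l (Suc v)))"

lemma free_vars_before: "free_vars (before l v) = {v}"
  by (induction l arbitrary: v) auto

lemma satisfies_before:
  "f v \<in> dg t \<Longrightarrow> satisfies (dg t) less_P less_V f (before l v) \<longleftrightarrow> l < fst (f v)"
proof (induction l arbitrary: f v)
  case 0
  then show ?case using dg_boundsD[OF 0] by simp
next
  case (Suc l)
  have "satisfies (dg t) less_P less_V (f(Suc v := a)) (before l (Suc v)) \<longleftrightarrow> l < fst a" if "a \<in> dg t" for a
    using Suc.IH[of "f(Suc v := a)" "Suc v", unfolded fun_upd_same, OF that] .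
  then have "satisfies (dg t) less_P less_V f (before (Suc l) v) \<longleftrightarrow> (\<exists>a\<in>dg t. less_P a (f v) \<and> l < fst a)"
    by (simp cong: bex_cong)
  also have "\<dots> \<longleftrightarrow> (\<exists>a\<in>dg t. fst a < fst (f v) \<and> l < fst a)" by (simp only: less_P_def)
  also have "\<dots> \<longleftrightarrow> Suc l < fst (f v)"
  proof
    \<comment> \<open>Positions have no gaps, so the point directly to the left exists, and it is
      the best first link of the chain.\<close>
    assume "Suc l < fst (f v)"
    moreover from this have "fst (f v) - 1 \<in> fst ` dg t"
      using dg_good[of t] dg_boundsD[OF Suc.prems] by (auto simp: good_def)
    then obtain a where "a \<in> dg t" "fst a = fst (f v) - 1" by auto
    ultimately show "\<exists>a\<in>dg t. fst a < fst (f v) \<and> l < fst a" by (intro bexI[of _ a]) auto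
  qed auto
  finally show ?case .
qed

definition max_at :: "nat \<Rightarrow> too_formula" where
  "max_at l = Exists 0 (Conj (Forall 1 (Neg (LessV 0 1))) (Conj (before l 0) (Neg (before (Suc l) 0))))"

lemma free_vars_max_at: "free_vars (max_at l) = {}"
  by (auto simp: max_at_def free_vars_before simp del: before.simps)

text \<open>The only point with no point above it is the root, whose position is one more than the
  size of the left subtree.\<close>

lemma satisfies_max_at:
  "satisfies (dg t) less_P less_V f (max_at l) \<longleftrightarrow> (\<exists>L R. t = Nd L R \<and> size L = l)"
proof -
  have "satisfies (dg t) less_P less_V f (max_at l) \<longleftrightarrow>
      (\<exists>a\<in>dg t. (\<forall>b\<in>dg t. \<not> snd a < snd b) \<and> fst a = Suc l)"
    using satisfies_before[of "f(0 := _)" 0 t]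
    by (auto simp: max_at_def less_V_def simp del: before.simps)
  also have "\<dots> \<longleftrightarrow> (\<exists>L R. t = Nd L R \<and> size L = l)"
  proof (cases t)
    case (Nd L R)
    have root: "(size L + 1, size t) \<in> dg t" using dg_Nd_root Nd by blast
    have "(\<forall>b\<in>dg t. \<not> snd a < snd b) \<longleftrightarrow> a = (size L + 1, size t)" if a: "a \<in> dg t" for a
    proof
      assume "\<forall>b\<in>dg t. \<not> snd a < snd b"
      then have "snd a = size t" using root dg_boundsD[OF a] by force
      then have "(fst a, size t) \<in> dg t" using a by (metis prod.collapse)
      then have "fst a = size L + 1" using dg_Nd_root Nd by blast
      then show "a = (size L + 1, size t)" using \<open>snd a = size t\<close> by (simp add: prod_eq_iff)
    next
      assume "a = (size L + 1, size t)"
      then show "\<forall>b\<in>dg t. \<not> snd a < snd b" using dg_boundsD(4) by (auto simp: not_less)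
    qed
    then have "(\<exists>a\<in>dg t. (\<forall>b\<in>dg t. \<not> snd a < snd b) \<and> fst a = Suc l) \<longleftrightarrow> size L = l"
      using root by auto
    then show ?thesis using Nd by auto
  qed simp
  finally show ?thesis .
qed

text \<open>The empty disjunction is a contradictory sentence; the universal formula under the
  negation also holds in the empty structure.\<close>

fun max_in :: "nat list \<Rightarrow> too_formula" where
  "max_in [] = Neg (Forall 0 (Eq 0 0))"
| "max_in (l # ls) = Disj (max_at l) (max_in ls)"

lemma sentence_max_in: "sentence (max_in ls)"
  by (induction ls) (auto simp: sentence_def free_vars_max_at)

lemma sat_tr_max_in: "sat_tr (max_in ls) = {t. \<exists>L R. t = Nd L R \<and> size L \<in> set ls}"
proof -
  have "satisfies (dg t) less_P less_V f (max_in ls) \<longleftrightarrow> (\<exists>L R. t = Nd L R \<and> size L \<in> set ls)" for t f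
    by (induction ls) (auto simp: satisfies_max_at)
  then show ?thesis by (simp add: sat_tr_def)
qed

text \<open>For large \<open>n\<close> the models are counted exactly by choosing the two root
  subtrees, and each term converges separately. The sum over \<open>set ls\<close> ignores
  repetitions.\<close>

lemma lim_max_in: "sat_prob (max_in ls) \<longlonglongrightarrow> (\<Sum>l\<in>set ls. wt l)"
proof -
  let ?F = "set ls" and ?S = "sat_tr (max_in ls)"
  have eq: "prop_tr ?S n = (\<Sum>l\<in>?F. real (cat l) * (real (cat (n - Suc l)) / real (cat n)))"
    \<comment> \<open>A crude bound on all entries at once, so that \<open>n - Suc l\<close> is
      never truncated.\<close>
    if n: "n > sum_list ls" for n
  proof -
    have le: "l < n" if "l \<in> ?F" for l
      using member_le_sum_list[OF that] n by simp
    have "?S \<inter> trees n = (\<Union>l\<in>?F. case_prod Nd ` (trees l \<times> trees (n - Suc l)))"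
    proof (intro equalityI subsetI)
      fix t assume "t \<in> ?S \<inter> trees n"
      then obtain L R where "t = Nd L R" "size L \<in> ?F" "R \<in> trees (n - Suc (size L))" "L \<in> trees (size L)"
        by (auto simp: sat_tr_max_in trees_def)
      then show "t \<in> (\<Union>l\<in>?F. case_prod Nd ` (trees l \<times> trees (n - Suc l)))" by force
    next
      fix t assume "t \<in> (\<Union>l\<in>?F. case_prod Nd ` (trees l \<times> trees (n - Suc l)))"
      then obtain L R where "t = Nd L R" "size L \<in> ?F" "size R = n - Suc (size L)"
        by (auto simp: trees_def)
      then show "t \<in> ?S \<inter> trees n" using le[of "size L"] by (auto simp: sat_tr_max_in trees_def)
    qed
    also have "card \<dots> = (\<Sum>l\<in>?F. card (case_prod Nd ` (trees l \<times> trees (n - Suc l))))"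
      by (rule card_UN_disjoint) (auto, auto simp: trees_def)
    also have "\<dots> = (\<Sum>l\<in>?F. cat l * cat (n - Suc l))"
      by (intro sum.cong refl) (subst card_image, auto simp: inj_on_def cat_def card_cartesian_product)
    finally show ?thesis by (simp add: prop_tr_def sum_divide_distrib)
  qed
  have "(\<lambda>n. \<Sum>l\<in>?F. real (cat l) * (real (cat (n - Suc l)) / real (cat n)))
      \<longlonglongrightarrow> (\<Sum>l\<in>?F. real (cat l) * (1/4) ^ Suc l)"
    by (intro tendsto_intros cat_ratio_shift)
  also have "(\<Sum>l\<in>?F. real (cat l) * (1/4) ^ Suc l) = (\<Sum>l\<in>?F. wt l)"
    by (simp add: wt_def power_one_over)
  finally have *: "(\<lambda>n. \<Sum>l\<in>?F. real (cat l) * (real (cat (n - Suc l)) / real (cat n))) \<longlonglongrightarrow> (\<Sum>l\<in>?F. wt l)" .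
  have "eventually (\<lambda>n. (\<Sum>l\<in>?F. real (cat l) * (real (cat (n - Suc l)) / real (cat n))) = prop_tr ?S n) sequentially"
    by (rule eventually_mono[OF eventually_gt_at_top[of "sum_list ls"]]) (rule eq[symmetric])
  with * show ?thesis
    unfolding sat_prob_eq[abs_def] by (rule Lim_transform_eventually)
qed

text \<open>The greedy choice never gets stuck because \<open>wt l \<le> tail_wt (Suc l)\<close>.\<close>

lemma greedy_subset_sum:
  assumes "0 \<le> x" "x \<le> 1/2"
  shows "\<exists>F. F \<subseteq> {..<j} \<and> 0 \<le> x - (\<Sum>l\<in>F. wt l) \<and> x - (\<Sum>l\<in>F. wt l) \<le> tail_wt j"
proof (induction j)
  case 0
  then show ?case using assms by (intro exI[of _ "{}"]) (simp add: tail_wt_0)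
next
  case (Suc j)
  then obtain F where F: "F \<subseteq> {..<j}" "0 \<le> x - (\<Sum>l\<in>F. wt l)" "x - (\<Sum>l\<in>F. wt l) \<le> tail_wt j" by blast
  show ?case
  proof (cases "wt j \<le> x - (\<Sum>l\<in>F. wt l)")
    case True
    have "(\<Sum>l\<in>insert j F. wt l) = wt j + (\<Sum>l\<in>F. wt l)"
      using F(1) by (intro sum.insert) (auto intro: finite_subset)
    then show ?thesis using True F tail_wt_eq[of j]
      by (intro exI[of _ "insert j F"]) auto
  next
    case False
    then show ?thesis using F wt_le_tail[of j] by (intro exI[of _ F]) auto
  qed
qed

lemma lims_dense_half:
  assumes "0 \<le> x" "x \<le> 1/2" "\<epsilon> > 0"
  obtains \<Psi> y where "sentence \<Psi>" "sat_prob \<Psi> \<longlonglongrightarrow> y" "\<bar>y - x\<bar> < \<epsilon>"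
proof -
  have "eventually (\<lambda>j. tail_wt j < \<epsilon>) sequentially"
    using tail_wt_tendsto_0 assms(3) by (rule order_tendstoD(2))
  then obtain j where j: "tail_wt j < \<epsilon>" by (auto simp: eventually_sequentially)
  obtain F where F: "F \<subseteq> {..<j}" "0 \<le> x - (\<Sum>l\<in>F. wt l)" "x - (\<Sum>l\<in>F. wt l) \<le> tail_wt j"
    using greedy_subset_sum[OF assms(1,2)] by blast
  have "finite F" using F(1) finite_subset by blast
  then obtain ls where "set ls = F" using finite_list by blast
  then show ?thesis using that[OF sentence_max_in lim_max_in, of ls] F j by auto
qed

lemma sat_prob_Neg: "sat_prob (Neg \<Psi>) n = 1 - sat_prob \<Psi> n"
proof -
  let ?S = "sat_tr \<Psi>"
  have "sat_tr (Neg \<Psi>) = - ?S" by (auto simp: sat_tr_def)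
  moreover have "real (card (- ?S \<inter> trees n)) = real (cat n) - real (card (?S \<inter> trees n))"
  proof -
    have "- ?S \<inter> trees n = trees n - ?S \<inter> trees n" by blast
    moreover have "card (?S \<inter> trees n) \<le> cat n" unfolding cat_def by (rule card_mono) auto
    ultimately show ?thesis by (simp add: card_Diff_subset cat_def of_nat_diff)
  qed
  ultimately show ?thesis
    using cat_pos[of n] by (simp add: sat_prob_eq prop_tr_def diff_divide_distrib)
qed

text \<open>Limits of probabilities stay in the closed interval, so density amounts to this equality
  of sets.\<close>

lemma closure_lims: "closure {lim (sat_prob \<Psi>) | \<Psi>. sentence \<Psi>} = {0..1}" (is "closure ?X = _")
proof
  have "lim (sat_prob \<Psi>) \<in> {0..1}" if "sentence \<Psi>" for \<Psi>
  proof -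
    have "sat_prob \<Psi> \<longlonglongrightarrow> lim (sat_prob \<Psi>)"
      using sat_prob_convergent[OF that] convergent_LIMSEQ_iff by blast
    moreover have "\<forall>n. sat_prob \<Psi> n \<in> {0..1}"
      by (simp add: sat_prob_eq prop_tr_nonneg prop_tr_le_1)
    ultimately show ?thesis by (metis closed_sequentially closed_real_atLeastAtMost)
  qed
  then show "closure ?X \<subseteq> {0..1}" by (intro closure_minimal) auto
next
  show "{0..1} \<subseteq> closure ?X"
  proof
    fix x :: real assume x: "x \<in> {0..1}"
    have "\<exists>y\<in>?X. dist y x < \<epsilon>" if e: "\<epsilon> > 0" for \<epsilon>
    proof (cases "x \<le> 1/2")
      case True
      obtain \<Psi> y where "sentence \<Psi>" "sat_prob \<Psi> \<longlonglongrightarrow> y" "\<bar>y - x\<bar> < \<epsilon>"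
        using lims_dense_half[of x \<epsilon>] x True e by auto
      then show ?thesis using limI by (fastforce simp: dist_real_def)
    next
      case False
      \<comment> \<open>The weights sum to 1/2 only, so above 1/2 the complement
        \<open>1 - x\<close> is approximated and the sentence negated.\<close>
      obtain \<Psi> y where P: "sentence \<Psi>" "sat_prob \<Psi> \<longlonglongrightarrow> y" "\<bar>y - (1 - x)\<bar> < \<epsilon>"
        using lims_dense_half[of "1 - x" \<epsilon>] x False e by auto
      have "sat_prob (Neg \<Psi>) \<longlonglongrightarrow> 1 - y"
        unfolding sat_prob_Neg[abs_def] by (intro tendsto_intros P)
      moreover have "sentence (Neg \<Psi>)" using P by (simp add: sentence_def)
      moreover have "\<bar>(1 - y) - x\<bar> < \<epsilon>" using P(3) by (simp add: abs_if split: if_splits)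
      ultimately show ?thesis using limI by (fastforce simp: dist_real_def)
    qed
    then show "x \<in> closure ?X" by (simp add: closure_approachable)
  qed
qed

theorem theorem1p1:
  shows "(\<forall>\<Psi>. sentence \<Psi> \<longrightarrow> convergent (sat_prob \<Psi>))
    \<and> (\<forall>\<Psi>. sentence \<Psi> \<longrightarrow>
          lim (sat_prob \<Psi>) > 0
          \<or> (\<exists>\<epsilon>::real. 0 < \<epsilon> \<and> \<epsilon> < 1 \<and> sat_prob \<Psi> \<in> O(\<lambda>n. \<epsilon> ^ n)))
    \<and> closure {lim (sat_prob \<Psi>) | \<Psi>. sentence \<Psi>} = {0..1}"
proof (intro conjI allI impI)
  fix \<Psi> assume "sentence \<Psi>"
  then have "inv_set (qdepth \<Psi>) (sat_tr \<Psi>)"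
    using sat_tr_invariant by (simp add: inv_set_def)
  from zero_or_positive[OF this]
  show "lim (sat_prob \<Psi>) > 0 \<or> (\<exists>\<epsilon>::real. 0 < \<epsilon> \<and> \<epsilon> < 1 \<and> sat_prob \<Psi> \<in> O(\<lambda>n. \<epsilon> ^ n))"
    by (simp add: sat_prob_eq[abs_def])
qed (simp_all add: sat_prob_convergent closure_lims)

end
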